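(* Let $F$ be a face of $A$, let $I$ be a $\mathfrak{p}_F$-primary monomial ideal in $\Bbbk[\mathbb{N}A]$, and let $[b_1,F],\dots,[b_\ell,F]$ be the (distinct) overlap classes of standard pairs of $I$ that are maximal with respect to divisibility. For each $1\le i\le\ell$, let $$T_i=\{c\in b+\mathbb{N}F\mid (b,F)\text{ is a standard pair of } I \text{ whose overlap class divides } [b_i,F]\}.$$ Then $T_i$ is the set of (exponents of) standard monomials of a monomial ideal $J_i$, i.e. $T_i=\mathrm{std}(J_i)$. Moreover $J_i\supseteq I$, $J_i$ is irreducible, and $I=J_1\cap\dots\cap J_\ell$ is an irredundant irreducible decomposition of $I$.
   Context: Standing assumptions: $\mathbb{N}=\{0,1,2,\dots\}$; $\Bbbk$ is an infinite field; $A=\{a_1,\dots,a_n\}\subset\mathbb{Z}^d\setminus\{0\}$ is a fixed finite set. $\mathbb{N}A$, $\mathbb{Z}A$, $\mathbb{R}_{\ge 0}A$ denote respectively the monoid of nonnegative integer combinations, the group of integer combinations, and the cone of nonnegative real combinations of elements of $A$ (similarly for subsets of $A$). It is assumed that $\mathbb{Z}A=\mathbb{Z}^d$ and that the cone $\mathbb{R}_{\ge 0}A$ is strongly convex (contains no lines). $\Bbbk[\mathbb{N}A]$ is the subring of the Laurent polynomial ring $\Bbbk[t_1^{\pm1},\dots,t_d^{\pm1}]$ with $\Bbbk$-basis the monomials $t^a$, $a\in\mathbb{N}A$. A monomial ideal is an ideal of $\Bbbk[\mathbb{N}A]$ generated by monomials $t^a$, $a \in \mathbb{N}A$. A face of $A$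 is a subset $F\subseteq A$ such that $\mathbb{R}_{\ge0}F$ is a face of the cone $\mathbb{R}_{\ge0}A$ and $\mathbb{R}_{\ge0}F\cap A=F$ (both $F=A$ and $F=\varnothing$, the latter corresponding to the origin, are allowed). For a face $F$, $\mathfrak{p}_F=\langle t^a\mid a\in\mathbb{N}A\setminus\mathbb{N}F\rangle$, a prime monomial ideal. A pair of $A$ is $(a,F)$ with $a\in\mathbb{N}A$ and $F$ a face of $A$; it is said to belong to $F$. Write $(a,F)\prec(b,G)$ if $a+\mathbb{N}F\subseteq b+\mathbb{N}G$. Pairs $(a,F)$ and $(b,F)$ overlap if $a-b\in\mathbb{Z}F$; this is an equivalence relation on pairs, and the class of $(a,F)$, its overlap class, is denoted $[a,F]$. The pair $(a,F)$ divides $(b,G)$ if there is $c\in\mathbb{N}A$ with $a+c+\mathbb{N}F\subseteq b+\mathbb{N}G$; this is well defined on overlap classes and is a partial order on them. For a monomial ideal $I$, $\mathrm{std}(I)=\{a\in\mathbb{N}A\mid t^a\notin I\}$. A proper pair of $I$ is a pair $(a,F)$ with $a+\mathbb{N}F\subseteq\mathrm{std}(I)$. A standard pair of $I$ is a proper pair of $I$ that is maximal with respect to $\prec$ among proper pairs of $I$. (All standard pairs of a $\mathfrak{p}_F$-primary monomial ideal belong to $F$, and maximal classes as below are finite in number.) An overlap class of standard pairs of $I$ is an overlap class containing at least one standard pair of $I$; it is maximal with respect to divisibility if it divides no other overlap class of standard pairs of $I$. An ideal is irreducible if it is proper and is not the intersection of two strictly larger ideals of the ring. *)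

theory Defs
  imports "HOL-Analysis.Polytope" "HOL-Library.Poly_Mapping" "HOL-Algebra.Ideal"
begin

text \<open>These three definitions are meant for finite \<^term>\<open>S\<close> only.\<close>

definition nat_combs :: "(int ^ 'd) set \<Rightarrow> (int ^ 'd) set" where
  "nat_combs S = {\<Sum>a\<in>S. int (c a) *s a | c :: int ^ 'd \<Rightarrow> nat. True}"

definition int_combs :: "(int ^ 'd) set \<Rightarrow> (int ^ 'd) set" where
  "int_combs S = {\<Sum>a\<in>S. c a *s a | c :: int ^ 'd \<Rightarrow> int. True}"

definition real_vec :: "int ^ 'd \<Rightarrow> real ^ 'd" where
  "real_vec a = (\<chi> i. real_of_int (a $ i))"

definition real_cone :: "(int ^ 'd) set \<Rightarrow> (real ^ 'd) set" where
  "real_cone S = {\<Sum>a\<in>S. c a *\<^sub>R real_vec a | c :: int ^ 'd \<Rightarrow> real. \<forall>a\<in>S. 0 \<le> c a}"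

definition contains_line :: "'v::real_vector set \<Rightarrow> bool" where
  "contains_line C \<longleftrightarrow> (\<exists>x v. v \<noteq> 0 \<and> (\<forall>t. x + t *\<^sub>R v \<in> C))"

definition is_face :: "(int ^ 'd) set \<Rightarrow> (int ^ 'd) set \<Rightarrow> bool" where
  "is_face A F \<longleftrightarrow>
     F \<subseteq> A \<and> real_cone F face_of real_cone A \<and> {a \<in> A. real_vec a \<in> real_cone F} = F"

definition ideal_radical :: "('a, 'm) ring_scheme \<Rightarrow> 'a set \<Rightarrow> 'a set" where
  "ideal_radical R Q = {x \<in> carrier R. \<exists>n::nat. x [^]\<^bsub>R\<^esub> n \<in> Q}"

definition primary_ideal :: "('a, 'm) ring_scheme \<Rightarrow> 'a set \<Rightarrow> bool" where
  "primary_ideal R Q \<longleftrightarrow>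
     ideal Q R \<and> Q \<noteq> carrier R \<and>
     (\<forall>x\<in>carrier R. \<forall>y\<in>carrier R. x \<otimes>\<^bsub>R\<^esub> y \<in> Q \<longrightarrow> x \<in> Q \<or> (\<exists>n::nat. y [^]\<^bsub>R\<^esub> n \<in> Q))"

definition primary_to :: "('a, 'm) ring_scheme \<Rightarrow> 'a set \<Rightarrow> 'a set \<Rightarrow> bool" where
  "primary_to R P Q \<longleftrightarrow> primary_ideal R Q \<and> ideal_radical R Q = P"

definition irreducible_ideal :: "('a, 'm) ring_scheme \<Rightarrow> 'a set \<Rightarrow> bool" where
  "irreducible_ideal R Q \<longleftrightarrow>
     ideal Q R \<and> Q \<noteq> carrier R \<and>
     \<not> (\<exists>J K. ideal J R \<and> ideal K R \<and> Q \<subset> J \<and> Q \<subset> K \<and> Q = J \<inter> K)"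

text \<open>In HOL an empty intersection is \<^term>\<open>UNIV\<close>; intersecting with the carrier makes the empty intersection the unit ideal.\<close>

definition irredundant_irreducible_decomposition ::
    "('a, 'm) ring_scheme \<Rightarrow> 'a set \<Rightarrow> 'i set \<Rightarrow> ('i \<Rightarrow> 'a set) \<Rightarrow> bool" where
  "irredundant_irreducible_decomposition R Q N J \<longleftrightarrow>
     finite N \<and> (\<forall>i\<in>N. irreducible_ideal R (J i)) \<and>
     Q = carrier R \<inter> (\<Inter>i\<in>N. J i) \<and>
     (\<forall>i\<in>N. Q \<noteq> carrier R \<inter> (\<Inter>j\<in>N - {i}. J j))"

text \<open>The type \<^typ>\<open>(int ^ 'd) \<Rightarrow>\<^sub>0 'k\<close> with its convolution product is the Laurent polynomial
  ring in variables indexed by \<^typ>\<open>'d\<close>; the ring below is its subring spanned by the monomials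
  with exponent in \<^term>\<open>nat_combs A\<close>.\<close>

definition semigroup_ring :: "(int ^ 'd) set \<Rightarrow> ((int ^ 'd) \<Rightarrow>\<^sub>0 'k::field) ring" where
  "semigroup_ring A =
     \<lparr>carrier = {p. Poly_Mapping.keys p \<subseteq> nat_combs A},
      monoid.mult = (*), one = 1, zero = 0, add = (+)\<rparr>"

definition tmon :: "int ^ 'd \<Rightarrow> (int ^ 'd) \<Rightarrow>\<^sub>0 'k::field" where
  "tmon a = Poly_Mapping.single a 1"

definition monomial_ideal :: "(int ^ 'd) set \<Rightarrow> ((int ^ 'd) \<Rightarrow>\<^sub>0 'k::field) set \<Rightarrow> bool" where
  "monomial_ideal A I \<longleftrightarrow>
     (\<exists>E \<subseteq> nat_combs A. I = Idl\<^bsub>semigroup_ring A\<^esub> (tmon ` E))"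

definition face_prime :: "(int ^ 'd) set \<Rightarrow> (int ^ 'd) set \<Rightarrow> ((int ^ 'd) \<Rightarrow>\<^sub>0 'k::field) set" where
  "face_prime A F = Idl\<^bsub>semigroup_ring A\<^esub> (tmon ` (nat_combs A - nat_combs F))"

definition std :: "(int ^ 'd) set \<Rightarrow> ((int ^ 'd) \<Rightarrow>\<^sub>0 'k::field) set \<Rightarrow> (int ^ 'd) set" where
  "std A I = {a \<in> nat_combs A. tmon a \<notin> I}"

type_synonym 'd pair = "(int ^ 'd) \<times> (int ^ 'd) set"

definition pairs :: "(int ^ 'd) set \<Rightarrow> 'd pair set" where
  "pairs A = {(a, F). a \<in> nat_combs A \<and> is_face A F}"

fun pair_set :: "'d::finite pair \<Rightarrow> (int ^ 'd) set" where
  "pair_set (a, F) = (+) a ` nat_combs F"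

definition overlap :: "(int ^ 'd) set \<Rightarrow> ('d pair \<times> 'd pair) set" where
  "overlap A = {((a, F), (b, G)).
     (a, F) \<in> pairs A \<and> (b, G) \<in> pairs A \<and> F = G \<and> a - b \<in> int_combs F}"

definition overlap_class :: "(int ^ 'd) set \<Rightarrow> 'd pair \<Rightarrow> 'd pair set" where
  "overlap_class A P = overlap A `` {P}"

fun pair_divides :: "(int ^ 'd) set \<Rightarrow> 'd::finite pair \<Rightarrow> 'd pair \<Rightarrow> bool" where
  "pair_divides A (a, F) Q \<longleftrightarrow> (\<exists>c\<in>nat_combs A. pair_set (a + c, F) \<subseteq> pair_set Q)"

text \<open>Divisibility does not depend on the representatives; see \<open>class_divides_iff\<close> below.\<close>

definition class_divides :: "(int ^ 'd) set \<Rightarrow> 'd::finite pair set \<Rightarrow> 'd pair set \<Rightarrow> bool" where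
  "class_divides A C D \<longleftrightarrow> (\<exists>P\<in>C. \<exists>Q\<in>D. pair_divides A P Q)"

definition proper_pair ::
    "(int ^ 'd) set \<Rightarrow> ((int ^ 'd) \<Rightarrow>\<^sub>0 'k::field) set \<Rightarrow> 'd::finite pair \<Rightarrow> bool" where
  "proper_pair A I P \<longleftrightarrow> P \<in> pairs A \<and> pair_set P \<subseteq> std A I"

definition standard_pair ::
    "(int ^ 'd) set \<Rightarrow> ((int ^ 'd) \<Rightarrow>\<^sub>0 'k::field) set \<Rightarrow> 'd::finite pair \<Rightarrow> bool" where
  "standard_pair A I P \<longleftrightarrow>
     proper_pair A I P \<and> (\<forall>Q. proper_pair A I Q \<and> pair_set P \<subseteq> pair_set Q \<longrightarrow> Q = P)"

definition standard_classes ::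
    "(int ^ 'd) set \<Rightarrow> ((int ^ 'd) \<Rightarrow>\<^sub>0 'k::field) set \<Rightarrow> 'd::finite pair set set" where
  "standard_classes A I = overlap_class A ` {P. standard_pair A I P}"

definition maximal_classes ::
    "(int ^ 'd) set \<Rightarrow> ((int ^ 'd) \<Rightarrow>\<^sub>0 'k::field) set \<Rightarrow> 'd::finite pair set set" where
  "maximal_classes A I =
     {C \<in> standard_classes A I. \<forall>D\<in>standard_classes A I. class_divides A C D \<longrightarrow> D = C}"

text \<open>Families of representatives \<open>b\<^sub>1, \<dots>, b\<^sub>l\<close> such that
  \<open>[b\<^sub>1, F], \<dots>, [b\<^sub>l, F]\<close> lists all maximal classes without repetition.\<close>

definition enumerates_maximal_classes ::
    "(int ^ 'd) set \<Rightarrow> (int ^ 'd) set \<Rightarrow> ((int ^ 'd) \<Rightarrow>\<^sub>0 'k::field) set \<Rightarrow> nat \<Rightarrow>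
     (nat \<Rightarrow> int ^ 'd::finite) \<Rightarrow> bool" where
  "enumerates_maximal_classes A F I l b \<longleftrightarrow>
     (\<forall>i\<in>{1..l}. (b i, F) \<in> pairs A) \<and>
     bij_betw (\<lambda>i. overlap_class A (b i, F)) {1..l} (maximal_classes A I)"

text \<open>The set \<open>T\<^sub>i\<close>, as a function of the representative \<open>b\<^sub>i\<close>.\<close>

definition divisor_set ::
    "(int ^ 'd) set \<Rightarrow> (int ^ 'd) set \<Rightarrow> ((int ^ 'd) \<Rightarrow>\<^sub>0 'k::field) set \<Rightarrow> int ^ 'd::finite \<Rightarrow>
     (int ^ 'd) set" where
  "divisor_set A F I b\<^sub>i =
     \<Union> {pair_set (b, F) | b. standard_pair A I (b, F) \<and>
        class_divides A (overlap_class A (b, F)) (overlap_class A (b\<^sub>i, F))}"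

lemma nat_combs_zero: "0 \<in> nat_combs S"
  unfolding nat_combs_def by (auto intro!: exI[of _ "\<lambda>_. 0"])

lemma nat_combs_add:
  assumes "x \<in> nat_combs S" "y \<in> nat_combs S" shows "x + y \<in> nat_combs S"
proof -
  from assms obtain c d where "x = (\<Sum>a\<in>S. int (c a) *s a)" "y = (\<Sum>a\<in>S. int (d a) *s a)"
    unfolding nat_combs_def by blast
  then have "x + y = (\<Sum>a\<in>S. int (c a + d a) *s a)"
    by (simp add: sum.distrib vector_sadd_rdistrib)
  then show ?thesis unfolding nat_combs_def by (auto intro!: exI[of _ "\<lambda>a. c a + d a"])
qed

lemma int_combs_iff: "x \<in> int_combs S \<longleftrightarrow> (\<exists>u\<in>nat_combs S. \<exists>v\<in>nat_combs S. x = u - v)"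
proof
  assume "x \<in> int_combs S"
  then obtain c where "x = (\<Sum>a\<in>S. c a *s a)"
    unfolding int_combs_def by blast
  also have "\<dots> = (\<Sum>a\<in>S. int (nat (c a)) *s a - int (nat (- c a)) *s a)"
  proof (intro sum.cong refl)
    fix a
    have "c a = int (nat (c a)) - int (nat (- c a))" by simp
    then show "c a *s a = int (nat (c a)) *s a - int (nat (- c a)) *s a"
      by (metis vector_ssub_ldistrib vector_sub_rdistrib)
  qed
  also have "\<dots> = (\<Sum>a\<in>S. int (nat (c a)) *s a) - (\<Sum>a\<in>S. int (nat (- c a)) *s a)"
    by (rule sum_subtractf)
  finally show "\<exists>u\<in>nat_combs S. \<exists>v\<in>nat_combs S. x = u - v"
    unfolding nat_combs_def
    by (intro bexI CollectI exI[of _ "\<lambda>a. nat (c a)"] exI[of _ "\<lambda>a. nat (- c a)"]) auto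
next
  assume "\<exists>u\<in>nat_combs S. \<exists>v\<in>nat_combs S. x = u - v"
  then obtain c d where "x = (\<Sum>a\<in>S. int (c a) *s a) - (\<Sum>a\<in>S. int (d a) *s a)"
    unfolding nat_combs_def by blast
  then have "x = (\<Sum>a\<in>S. (int (c a) - int (d a)) *s a)"
    by (simp add: sum_subtractf[symmetric] vec_eq_iff left_diff_distrib)
  then show "x \<in> int_combs S"
    unfolding int_combs_def by (auto intro!: exI[of _ "\<lambda>a. int (c a) - int (d a)"])
qed

lemma cring_semigroup_ring: "cring (semigroup_ring A :: ((int ^ 'd) \<Rightarrow>\<^sub>0 'k::field) ring)"
proof -
  let ?R = "semigroup_ring A :: ((int ^ 'd) \<Rightarrow>\<^sub>0 'k) ring"
  have keys_mult: "Poly_Mapping.keys (p * q) \<subseteq> nat_combs A"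
    if "Poly_Mapping.keys p \<subseteq> nat_combs A" "Poly_Mapping.keys q \<subseteq> nat_combs A"
    for p q :: "(int ^ 'd) \<Rightarrow>\<^sub>0 'k"
    using Poly_Mapping.keys_mult[of p q] that nat_combs_add by blast
  have keys_plus: "Poly_Mapping.keys (p + q) \<subseteq> nat_combs A"
    if "Poly_Mapping.keys p \<subseteq> nat_combs A" "Poly_Mapping.keys q \<subseteq> nat_combs A"
    for p q :: "(int ^ 'd) \<Rightarrow>\<^sub>0 'k"
    using Poly_Mapping.keys_add[of p q] that by blast
  show ?thesis
  proof (rule cringI)
    show "abelian_group ?R"
    proof (rule abelian_groupI)
      fix p assume "p \<in> carrier ?R"
      then show "\<exists>q\<in>carrier ?R. q \<oplus>\<^bsub>?R\<^esub> p = \<zero>\<^bsub>?R\<^esub>"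
        by (intro bexI[of _ "- p"]) (auto simp: semigroup_ring_def)
    qed (use keys_plus in \<open>auto simp: semigroup_ring_def ac_simps\<close>)
    show "comm_monoid ?R"
      by (rule comm_monoidI)
        (use keys_mult nat_combs_zero[of A] in \<open>auto simp: semigroup_ring_def ac_simps\<close>)
  qed (simp add: semigroup_ring_def distrib_right)
qed

lemma equiv_overlap: "equiv (pairs A) (overlap A)"
proof (rule equivI)
  have zero: "0 \<in> int_combs S" for S :: "(int ^ 'd) set"
    using nat_combs_zero by (force simp: int_combs_iff)
  have neg: "b - a \<in> int_combs S" if "a - b \<in> int_combs S" for S and a b :: "int ^ 'd"
    using that unfolding int_combs_iff by (metis minus_diff_eq)
  have add: "a - c \<in> int_combs S" if ab: "a - b \<in> int_combs S" and bc: "b - c \<in> int_combs S"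
    for S and a b c :: "int ^ 'd"
  proof -
    obtain u v where uv: "u \<in> nat_combs S" "v \<in> nat_combs S" "a - b = u - v"
      using ab unfolding int_combs_iff by blast
    obtain u' v' where uv': "u' \<in> nat_combs S" "v' \<in> nat_combs S" "b - c = u' - v'"
      using bc unfolding int_combs_iff by blast
    have "a - c = (u + u') - (v + v')"
      using arg_cong2[OF uv(3) uv'(3), of "(+)"] by (simp add: algebra_simps)
    then show ?thesis
      unfolding int_combs_iff using uv uv' nat_combs_add by blast
  qed
  show "overlap A \<subseteq> pairs A \<times> pairs A" by (auto simp: overlap_def)
  show "refl_on (pairs A) (overlap A)" by (auto simp: refl_on_def overlap_def zero)
  show "sym (overlap A)" by (auto simp: sym_def overlap_def neg)
  show "trans (overlap A)" by (auto simp: trans_def overlap_def intro: add)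
qed

lemma nat_combs_mono:
  assumes "finite T" "S \<subseteq> T" shows "nat_combs S \<subseteq> nat_combs T"
proof
  fix x assume "x \<in> nat_combs S"
  then obtain c where "x = (\<Sum>a\<in>S. int (c a) *s a)" unfolding nat_combs_def by blast
  also have "\<dots> = (\<Sum>a\<in>T. int (if a \<in> S then c a else 0) *s a)"
    by (rule sum.mono_neutral_cong_left) (use assms in auto)
  finally show "x \<in> nat_combs T"
    unfolding nat_combs_def by (auto intro!: exI[of _ "\<lambda>a. if a \<in> S then c a else 0"])
qed

lemma pair_divides_iff:
  "pair_divides A (a, F) (b, G) \<longleftrightarrow>
     (\<exists>c\<in>nat_combs A. \<forall>f\<in>nat_combs F. a + c + f - b \<in> nat_combs G)"
proof -
  have "y \<in> (+) b ` nat_combs G \<longleftrightarrow> y - b \<in> nat_combs G" for y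
  proof
    assume "y - b \<in> nat_combs G"
    then have "b + (y - b) \<in> (+) b ` nat_combs G" by (rule imageI)
    then show "y \<in> (+) b ` nat_combs G" by simp
  qed auto
  then have "pair_set (x, F) \<subseteq> pair_set (b, G) \<longleftrightarrow>
      (\<forall>f\<in>nat_combs F. x + f - b \<in> nat_combs G)" for x
    by auto
  then show ?thesis by simp
qed

lemma pair_divides_overlap:
  assumes A: "finite A" and PP': "(P, P') \<in> overlap A" and QQ': "(Q, Q') \<in> overlap A"
    and PQ: "pair_divides A P Q"
  shows "pair_divides A P' Q'"
proof -
  obtain a a' F where P: "P = (a, F)" "P' = (a', F)" "F \<subseteq> A" "a - a' \<in> int_combs F"
    using PP' by (auto simp: overlap_def pairs_def is_face_def)
  obtain b b' G where Q: "Q = (b, G)" "Q' = (b', G)" "G \<subseteq> A" "b - b' \<in> int_combs G"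
    using QQ' by (auto simp: overlap_def pairs_def is_face_def)
  obtain u v where uv: "u \<in> nat_combs F" "v \<in> nat_combs F" "a - a' = u - v"
    using P(4) unfolding int_combs_iff by blast
  obtain w z where wz: "w \<in> nat_combs G" "z \<in> nat_combs G" "b - b' = w - z"
    using Q(4) unfolding int_combs_iff by blast
  obtain c where c: "c \<in> nat_combs A" "\<And>f. f \<in> nat_combs F \<Longrightarrow> a + c + f - b \<in> nat_combs G"
    using PQ unfolding P Q pair_divides_iff by blast
  have "u \<in> nat_combs A" "z \<in> nat_combs A"
    using uv(1) wz(2) nat_combs_mono[OF A P(3)] nat_combs_mono[OF A Q(3)] by auto
  then have "c + u + z \<in> nat_combs A"
    using c(1) by (simp add: nat_combs_add)
  moreover have "a' + (c + u + z) + f - b' \<in> nat_combs G" if f: "f \<in> nat_combs F" for f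
  proof -
    have "a + c + (v + f) - b + w \<in> nat_combs G"
      using c(2)[OF nat_combs_add[OF uv(2) f]] wz(1) by (rule nat_combs_add)
    moreover have a': "a' = a - u + v" and b': "b' = b - w + z"
      using uv(3) wz(3) by (simp_all add: algebra_simps)
    have "a + c + (v + f) - b + w = a' + (c + u + z) + f - b'"
      unfolding a' b' by simp
    ultimately show ?thesis by simp
  qed
  ultimately show ?thesis unfolding P Q pair_divides_iff by blast
qed

lemma class_divides_iff:
  assumes "finite A" "P \<in> pairs A" "Q \<in> pairs A"
  shows "class_divides A (overlap_class A P) (overlap_class A Q) \<longleftrightarrow> pair_divides A P Q"
proof
  have refl: "(P, P) \<in> overlap A" "(Q, Q) \<in> overlap A"
    using equiv_overlap[of A] assms(2,3) by (auto simp: equiv_def refl_on_def)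
  show "pair_divides A P Q \<Longrightarrow> class_divides A (overlap_class A P) (overlap_class A Q)"
    using refl unfolding class_divides_def overlap_class_def by blast
  assume "class_divides A (overlap_class A P) (overlap_class A Q)"
  then obtain P' Q' where "(P, P') \<in> overlap A" "(Q, Q') \<in> overlap A" "pair_divides A P' Q'"
    unfolding class_divides_def overlap_class_def by blast
  moreover have "sym (overlap A)" using equiv_overlap[of A] by (simp add: equiv_def)
  ultimately show "pair_divides A P Q"
    using pair_divides_overlap[OF assms(1)] by (meson symD)
qed

end

theory Submission
  imports Defs
begin

text \<open>
  Write \<open>M\<close> and \<open>N\<close> for the monoids generated by \<open>A\<close> and \<open>F\<close>. A monomial ideal is determined by its
  set of exponents, so \<open>I\<close> can be replaced by the set \<open>D\<close> of its standard exponents. This set is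
  closed under division. As \<open>I\<close> is primary to the prime of \<open>F\<close>, it is also stable under adding
  elements of \<open>N\<close> (\<open>std_add_face\<close>), and it misses some multiple of every element of \<open>M\<close> outside
  \<open>N\<close> (\<open>multiple_notin_std\<close>). The last property forces all standard pairs to belong to \<open>F\<close> and bounds the
  coefficients of standard exponents along \<open>A - F\<close>, so that \<open>D\<close> meets finitely many classes modulo the
  group of \<open>F\<close> (\<open>finite_standard_classes\<close>). Strong convexity provides a grading of \<open>M\<close>, and
  with it every standard exponent is covered by a standard pair (\<open>std_covered\<close>). Consequently the
  overlap classes of standard pairs are just the classes of elements of \<open>D\<close>
  (\<open>standard_classes_eq\<close>), and divisibility of classes is the preorder \<open>x \<preceq> y\<close>, meaning that
  \<open>y - x = m - f\<close> for some \<open>m\<close> in \<open>M\<close> and \<open>f\<close> in \<open>N\<close>.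

  The set of exponents attached to a maximal class of \<open>b\<close> is the principal down-set of \<open>b\<close> for this
  preorder (\<open>divisor_set_eq\<close>). Down-sets are complements of monomial ideals. Their union over the
  maximal classes is \<open>D\<close>, because a finite preorder has a maximal element above every element
  (\<open>divides_maximal\<close>), and no one of them can be omitted, because \<open>b\<close> divides no other maximal class.

  The ring-theoretic content is that the complement \<open>J\<close> of a principal down-set is irreducible among
  all ideals, not only among monomial ones (\<open>irreducible_lower_set\<close>). Any ideal strictly larger than
  \<open>J\<close> contains \<open>t\<^sup>b q\<close> for some nonzero \<open>q\<close> supported in \<open>N\<close>
  (\<open>larger_ideal_meets_face_translate\<close>). If two larger ideals contain \<open>t\<^sup>b p\<close> and \<open>t\<^sup>b q\<close>, both
  contain \<open>t\<^sup>b p q\<close>. The Laurent polynomial ring is a domain (\<open>laurent_no_zero_divisors\<close>), so this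
  is nonzero, and its support, contained in \<open>b + N\<close>, avoids the exponents of \<open>J\<close>. Hence \<open>J\<close> is strictly smaller
  than the intersection.
\<close>

section \<open>Laurent polynomials\<close>

text \<open>Finitely many hyperplanes through the origin do not fill the space. If \<open>w\<close> avoids all hyperplanes
  but that of \<open>v\<close>, then on the line \<open>t w + v\<close> each of the other hyperplanes excludes one value of \<open>t\<close>,
  and that of \<open>v\<close> excludes none.\<close>

lemma hyperplanes_avoidable:
  fixes V :: "'a::real_inner set"
  assumes "finite V" "0 \<notin> V"
  shows "\<exists>w. \<forall>v\<in>V. w \<bullet> v \<noteq> 0"
  using assms
proof (induction V)
  case empty
  then show ?case by simp
next
  case (insert v V)
  then obtain w where w: "\<And>u. u \<in> V \<Longrightarrow> w \<bullet> u \<noteq> 0" by auto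
  show ?case
  proof (cases "w \<bullet> v = 0")
    case False
    then show ?thesis using w by blast
  next
    case True
    have "finite ((\<lambda>u. - (v \<bullet> u) / (w \<bullet> u)) ` V)"
      using insert.hyps by simp
    then obtain t where t: "t \<notin> (\<lambda>u. - (v \<bullet> u) / (w \<bullet> u)) ` V"
      using ex_new_if_finite[OF infinite_UNIV_char_0] by blast
    have "(t *\<^sub>R w + v) \<bullet> u \<noteq> 0" if "u \<in> V" for u
    proof
      assume "(t *\<^sub>R w + v) \<bullet> u = 0"
      then have "t = - (v \<bullet> u) / (w \<bullet> u)"
        using w[OF that] by (simp add: inner_left_distrib field_simps)
      then show False using t that by blast
    qed
    moreover have "(t *\<^sub>R w + v) \<bullet> v \<noteq> 0"
      using True insert.prems by (simp add: inner_left_distrib)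
    ultimately show ?thesis by blast
  qed
qed

lemma real_vec_simps [simp]:
  "real_vec 0 = 0" "real_vec (a + b) = real_vec a + real_vec b"
  "real_vec (a - b) = real_vec a - real_vec b"
  "real_vec (n *s a) = of_int n *\<^sub>R real_vec a"
  by (auto simp: real_vec_def vec_eq_iff)

lemma real_vec_sum: "real_vec (sum g S) = (\<Sum>a\<in>S. real_vec (g a))"
  by (induction S rule: infinite_finite_induct) auto

lemma real_vec_eq_iff [simp]: "real_vec a = real_vec b \<longleftrightarrow> a = b"
  by (auto simp: real_vec_def vec_eq_iff)

lemma real_vec_eq_0_iff [simp]: "real_vec a = 0 \<longleftrightarrow> a = 0"
  by (auto simp: real_vec_def vec_eq_iff)

lemma poly_mapping_split:
  fixes p :: "'a \<Rightarrow>\<^sub>0 'b::comm_monoid_add"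
  obtains q r where "p = q + r" "Poly_Mapping.keys q = Poly_Mapping.keys p \<inter> S"
    "Poly_Mapping.keys r = Poly_Mapping.keys p - S"
proof -
  have fin: "finite {k. (if k \<in> S' then Poly_Mapping.lookup p k else 0) \<noteq> 0}" for S'
    by (rule finite_subset[OF _ finite_keys[of p]]) (auto simp: in_keys_iff split: if_splits)
  define q where "q = Abs_poly_mapping (\<lambda>k. if k \<in> S then Poly_Mapping.lookup p k else 0)"
  define r where "r = Abs_poly_mapping (\<lambda>k. if k \<in> - S then Poly_Mapping.lookup p k else 0)"
  have q: "Poly_Mapping.lookup q k = (if k \<in> S then Poly_Mapping.lookup p k else 0)" for k
    unfolding q_def using fin[of S] by (subst lookup_Abs_poly_mapping) auto
  have r: "Poly_Mapping.lookup r k = (if k \<in> - S then Poly_Mapping.lookup p k else 0)" for k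
    unfolding r_def using fin[of "- S"] by (subst lookup_Abs_poly_mapping) auto
  show ?thesis
  proof (rule that)
    show "p = q + r" by (rule poly_mapping_eqI) (auto simp: lookup_add q r)
  qed (auto simp: in_keys_iff q r split: if_splits)
qed

lemma tmon_mult: "tmon a * tmon b = tmon (a + b)"
  by (simp add: tmon_def mult_single)

lemma tmon_0: "tmon 0 = 1"
  by (simp add: tmon_def)

lemma keys_tmon [simp]: "Poly_Mapping.keys (tmon a :: _ \<Rightarrow>\<^sub>0 'k::field) = {a}"
  by (simp add: tmon_def)

lemma keys_tmon_mult:
  "Poly_Mapping.keys (tmon m * p :: (int ^ 'd) \<Rightarrow>\<^sub>0 'k::field) = (+) m ` Poly_Mapping.keys p"
proof
  have sub: "Poly_Mapping.keys (tmon m * p) \<subseteq> (+) m ` Poly_Mapping.keys p"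
    for m and p :: "(int ^ 'd) \<Rightarrow>\<^sub>0 'k"
    using keys_mult[of "tmon m" p] by auto
  show "Poly_Mapping.keys (tmon m * p) \<subseteq> (+) m ` Poly_Mapping.keys p" by (rule sub)
  have "tmon (- m) * (tmon m * p) = p"
    by (simp add: mult.assoc[symmetric] tmon_mult tmon_0)
  then have "Poly_Mapping.keys p \<subseteq> (+) (- m) ` Poly_Mapping.keys (tmon m * p)"
    using sub[of "- m" "tmon m * p"] by simp
  then show "(+) m ` Poly_Mapping.keys p \<subseteq> Poly_Mapping.keys (tmon m * p)"
    by force
qed

text \<open>A linear functional \<open>h\<close> that is injective on the finite supports of both factors provides leading
  terms: their product is the only contribution to the exponent that is the sum of the two leading
  exponents.\<close>

lemma laurent_no_zero_divisors:
  fixes p q :: "(int ^ 'd::finite) \<Rightarrow>\<^sub>0 'k::field"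
  assumes "p \<noteq> 0" "q \<noteq> 0"
  shows "p * q \<noteq> 0"
proof -
  let ?K = "Poly_Mapping.keys p \<union> Poly_Mapping.keys q"
  have "finite ((\<lambda>(x, y). real_vec (x - y)) ` (?K \<times> ?K) - {0})" by simp
  then obtain w where w: "\<And>v. v \<in> (\<lambda>(x, y). real_vec (x - y)) ` (?K \<times> ?K) - {0} \<Longrightarrow> w \<bullet> v \<noteq> 0"
    using hyperplanes_avoidable by (metis Diff_iff insertCI)
  define h where "h x = w \<bullet> real_vec x" for x
  have inj: "x = y" if "x \<in> ?K" "y \<in> ?K" "h x = h y" for x y
  proof (rule ccontr)
    assume "x \<noteq> y"
    then have "real_vec (x - y) \<noteq> 0" by simp
    then have "w \<bullet> real_vec (x - y) \<noteq> 0" using that(1,2) by (intro w) force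
    then show False using that(3) by (simp add: h_def inner_diff_right)
  qed
  have top: "\<exists>x\<in>Poly_Mapping.keys r. \<forall>x'\<in>Poly_Mapping.keys r - {x}. h x' < h x"
    if r: "r \<noteq> 0" "Poly_Mapping.keys r \<subseteq> ?K" for r :: "(int ^ 'd) \<Rightarrow>\<^sub>0 'k"
  proof -
    have ne: "h ` Poly_Mapping.keys r \<noteq> {}" "finite (h ` Poly_Mapping.keys r)"
      using r(1) by auto
    from Max_in[OF ne(2,1)]
    obtain x where x: "x \<in> Poly_Mapping.keys r" "h x = Max (h ` Poly_Mapping.keys r)"
      by (metis imageE)
    have "h x' < h x" if "x' \<in> Poly_Mapping.keys r - {x}" for x'
    proof -
      have "h x' \<le> h x" using that ne x(2) by simp
      moreover have "h x' \<noteq> h x" using inj[of x' x] that x(1) r(2) by auto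
      ultimately show ?thesis by simp
    qed
    then show ?thesis using x(1) by blast
  qed
  obtain x where x: "x \<in> Poly_Mapping.keys p" "\<And>x'. x' \<in> Poly_Mapping.keys p - {x} \<Longrightarrow> h x' < h x"
    using top[OF assms(1)] by blast
  obtain y where y: "y \<in> Poly_Mapping.keys q" "\<And>y'. y' \<in> Poly_Mapping.keys q - {y} \<Longrightarrow> h y' < h y"
    using top[OF assms(2)] by blast
  obtain p1 p2 where p: "p = p1 + p2" "Poly_Mapping.keys p1 = Poly_Mapping.keys p \<inter> {x}"
    "Poly_Mapping.keys p2 = Poly_Mapping.keys p - {x}"
    by (rule poly_mapping_split)
  obtain q1 q2 where q: "q = q1 + q2" "Poly_Mapping.keys q1 = Poly_Mapping.keys q \<inter> {y}"
    "Poly_Mapping.keys q2 = Poly_Mapping.keys q - {y}"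
    by (rule poly_mapping_split)
  have single: "\<exists>c. c \<noteq> 0 \<and> r = Poly_Mapping.single z c"
    if "Poly_Mapping.keys r = {z}" for r :: "(int ^ 'd) \<Rightarrow>\<^sub>0 'k" and z
  proof (intro exI conjI)
    show "Poly_Mapping.lookup r z \<noteq> 0" using that by (simp flip: in_keys_iff)
    show "r = Poly_Mapping.single z (Poly_Mapping.lookup r z)"
      using that
      by (intro poly_mapping_eqI) (auto simp: lookup_single when_def simp flip: not_in_keys_iff_lookup_eq_zero)
  qed
  obtain c where c: "c \<noteq> 0" "p1 = Poly_Mapping.single x c" using single[of p1 x] p(2) x(1) by auto
  obtain d where d: "d \<noteq> 0" "q1 = Poly_Mapping.single y d" using single[of q1 y] q(2) y(1) by auto
  have "x + y \<notin> Poly_Mapping.keys (p1 * q2)"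
  proof
    assume "x + y \<in> Poly_Mapping.keys (p1 * q2)"
    then obtain y' where "y' \<in> Poly_Mapping.keys q2" "x + y = x + y'"
      using keys_mult[of p1 q2] p(2) by auto
    then show False using q(3) by simp
  qed
  moreover have "x + y \<notin> Poly_Mapping.keys (p2 * q)"
  proof
    assume "x + y \<in> Poly_Mapping.keys (p2 * q)"
    then obtain x' y' where x': "x' \<in> Poly_Mapping.keys p2" and y': "y' \<in> Poly_Mapping.keys q"
      and eq: "x + y = x' + y'"
      using keys_mult[of p2 q] by auto
    have "h x' < h x" using x' p(3) by (intro x(2)) simp
    moreover have "h y' \<le> h y" using y(2)[of y'] y' by force
    moreover have "h x + h y = h x' + h y'"
      using arg_cong[OF eq, of h] by (simp add: h_def inner_right_distrib)
    ultimately show False by simp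
  qed
  moreover have "p * q = p1 * q1 + p1 * q2 + p2 * q" by (simp add: p(1) q(1) algebra_simps)
  ultimately have "Poly_Mapping.lookup (p * q) (x + y) = c * d"
    by (simp add: lookup_add not_in_keys_iff_lookup_eq_zero c(2) d(2) mult_single)
  then show ?thesis using c(1) d(1) by auto
qed

section \<open>Monomial ideals\<close>

definition monomial_span :: "(int ^ 'd) set \<Rightarrow> ((int ^ 'd) \<Rightarrow>\<^sub>0 'k::field) set" where
  "monomial_span U = {p. Poly_Mapping.keys p \<subseteq> U}"

lemma tmon_in_monomial_span_iff [simp]: "tmon a \<in> monomial_span U \<longleftrightarrow> a \<in> U"
  by (simp add: monomial_span_def)

lemma carrier_semigroup_ring: "carrier (semigroup_ring A) = monomial_span (nat_combs A)"
  by (simp add: semigroup_ring_def monomial_span_def)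

lemma semigroup_ring_ops [simp]:
  "mult (semigroup_ring A) = (*)" "add (semigroup_ring A) = (+)"
  "one (semigroup_ring A) = 1" "zero (semigroup_ring A) = 0"
  by (simp_all add: semigroup_ring_def)

text \<open>These are the semigroup ideals of the monoid generated by \<open>A\<close>.\<close>

definition exponent_ideal :: "(int ^ 'd) set \<Rightarrow> (int ^ 'd) set \<Rightarrow> bool" where
  "exponent_ideal A U \<longleftrightarrow> U \<subseteq> nat_combs A \<and> (\<forall>u\<in>U. \<forall>m\<in>nat_combs A. u + m \<in> U)"

text \<open>The ring axioms of an ideal, restated with the operations of the ambient Laurent polynomial type.\<close>

lemma ideal_closed:
  assumes "ideal K (semigroup_ring A)"
  shows ideal_closed_0: "0 \<in> K"
    and ideal_closed_add: "p \<in> K \<Longrightarrow> q \<in> K \<Longrightarrow> p + q \<in> K"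
    and ideal_closed_mult: "p \<in> K \<Longrightarrow> q \<in> monomial_span (nat_combs A) \<Longrightarrow> q * p \<in> K"
    and ideal_closed_subset: "K \<subseteq> monomial_span (nat_combs A)"
    and ideal_closed_diff: "p \<in> K \<Longrightarrow> q \<in> K \<Longrightarrow> p - q \<in> K"
proof -
  interpret K: ideal K "semigroup_ring A" by fact
  show "0 \<in> K" using additive_subgroup.zero_closed[OF ideal.axioms(1)[OF assms]] by simp
  show add: "p \<in> K \<Longrightarrow> q \<in> K \<Longrightarrow> p + q \<in> K" for p q using additive_subgroup.a_closed[OF ideal.axioms(1)[OF assms]] by simp
  show mult: "p \<in> K \<Longrightarrow> q \<in> monomial_span (nat_combs A) \<Longrightarrow> q * p \<in> K" for p q
    using K.I_l_closed by (simp add: carrier_semigroup_ring)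
  show "K \<subseteq> monomial_span (nat_combs A)"
    using K.a_subset by (simp add: carrier_semigroup_ring)
  have "- 1 * q \<in> K" if "q \<in> K" for q
    using that by (intro mult) (simp_all add: monomial_span_def nat_combs_zero)
  then show "p \<in> K \<Longrightarrow> q \<in> K \<Longrightarrow> p - q \<in> K"
    using add[of p "- q"] by simp
qed

lemma ideal_monomial_span:
  assumes "exponent_ideal A U"
  shows "ideal (monomial_span U :: ((int ^ 'd) \<Rightarrow>\<^sub>0 'k::field) set) (semigroup_ring A)"
proof -
  let ?R = "semigroup_ring A :: ((int ^ 'd) \<Rightarrow>\<^sub>0 'k) ring"
  interpret cring ?R by (rule cring_semigroup_ring)
  have U: "U \<subseteq> nat_combs A" "\<And>u m. u \<in> U \<Longrightarrow> m \<in> nat_combs A \<Longrightarrow> u + m \<in> U"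
    using assms by (auto simp: exponent_ideal_def)
  have mult: "p * q \<in> monomial_span U" "q * p \<in> monomial_span U"
    if "p \<in> monomial_span U" "q \<in> carrier ?R" for p q
  proof -
    show "p * q \<in> monomial_span U"
      using that keys_mult[of p q] U(2) by (fastforce simp: monomial_span_def carrier_semigroup_ring)
    then show "q * p \<in> monomial_span U" by (simp add: mult.commute)
  qed
  show ?thesis
  proof (rule idealI)
    show "subgroup (monomial_span U) (add_monoid ?R)"
    proof (rule add.subgroupI)
      show "monomial_span U \<subseteq> carrier ?R"
        using U(1) by (auto simp: carrier_semigroup_ring monomial_span_def)
      have "0 \<in> (monomial_span U :: ((int ^ 'd) \<Rightarrow>\<^sub>0 'k) set)" by (simp add: monomial_span_def)
      then show "monomial_span U \<noteq> ({} :: ((int ^ 'd) \<Rightarrow>\<^sub>0 'k) set)" by blast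
    next
      fix p :: "(int ^ 'd) \<Rightarrow>\<^sub>0 'k" assume p: "p \<in> monomial_span U"
      then have pc: "p \<in> carrier ?R"
        using U(1) by (auto simp: carrier_semigroup_ring monomial_span_def)
      moreover have "- p \<in> carrier ?R"
        using pc by (auto simp: carrier_semigroup_ring monomial_span_def in_keys_iff subset_iff)
      ultimately have "\<ominus>\<^bsub>?R\<^esub> p = - p"
        by (intro minus_equality) auto
      then show "\<ominus>\<^bsub>?R\<^esub> p \<in> monomial_span U"
        using p by (auto simp: monomial_span_def in_keys_iff subset_iff)
    next
      fix p q :: "(int ^ 'd) \<Rightarrow>\<^sub>0 'k" assume "p \<in> monomial_span U" "q \<in> monomial_span U"
      then show "p \<oplus>\<^bsub>?R\<^esub> q \<in> monomial_span U"
        using keys_add[of p q] by (auto simp: monomial_span_def)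
    qed
  qed (use mult in \<open>auto intro: ring_axioms\<close>)
qed

lemma monomial_span_subset_ideal:
  fixes K :: "((int ^ 'd) \<Rightarrow>\<^sub>0 'k::field) set"
  assumes K: "ideal K (semigroup_ring A)" and U: "tmon ` U \<subseteq> K"
  shows "monomial_span U \<subseteq> K"
proof
  fix p :: "(int ^ 'd) \<Rightarrow>\<^sub>0 'k" assume "p \<in> monomial_span U"
  then have keys: "Poly_Mapping.keys p \<subseteq> U" by (simp add: monomial_span_def)
  have monom: "Poly_Mapping.single k (Poly_Mapping.lookup p k) \<in> K" if "k \<in> Poly_Mapping.keys p" for k
  proof -
    have "Poly_Mapping.single 0 (Poly_Mapping.lookup p k) * tmon k \<in> K"
      using that keys U
      by (intro ideal_closed_mult[OF K]) (auto simp: monomial_span_def nat_combs_zero)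
    then show ?thesis by (simp add: tmon_def mult_single)
  qed
  have "(\<Sum>k\<in>S. Poly_Mapping.single k (Poly_Mapping.lookup p k)) \<in> K" if "S \<subseteq> Poly_Mapping.keys p" for S
    using finite_subset[OF that finite_keys] that
    by (induction S rule: finite_induct) (auto intro: ideal_closed_0[OF K] ideal_closed_add[OF K] monom)
  moreover have "(\<Sum>k\<in>Poly_Mapping.keys p. Poly_Mapping.single k (Poly_Mapping.lookup p k)) = p"
    by (rule poly_mapping_eqI)
      (auto simp: lookup_sum lookup_single when_def sum.If_cases in_keys_iff not_in_keys_iff_lookup_eq_zero)
  ultimately show "p \<in> K" by (metis order_refl)
qed

lemma genideal_tmon:
  assumes E: "E \<subseteq> nat_combs A"
  defines "U \<equiv> {e + m | e m. e \<in> E \<and> m \<in> nat_combs A}"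
  shows "exponent_ideal A U"
    and "Idl\<^bsub>semigroup_ring A\<^esub> (tmon ` E) = (monomial_span U :: ((int ^ 'd) \<Rightarrow>\<^sub>0 'k::field) set)"
proof -
  let ?R = "semigroup_ring A :: ((int ^ 'd) \<Rightarrow>\<^sub>0 'k) ring"
  interpret cring ?R by (rule cring_semigroup_ring)
  have "e + m + m' \<in> U" if "e \<in> E" "m \<in> nat_combs A" "m' \<in> nat_combs A" for e m m'
    unfolding U_def using that nat_combs_add[of m A m'] by (auto simp: add.assoc)
  then show U: "exponent_ideal A U"
    using E by (auto simp: exponent_ideal_def U_def intro: nat_combs_add)
  have car: "tmon ` E \<subseteq> carrier ?R" using E by (auto simp: carrier_semigroup_ring)
  have EU: "E \<subseteq> U"
  proof
    fix e assume "e \<in> E"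
    then have "e = e + 0 \<and> e \<in> E \<and> 0 \<in> nat_combs A" by (simp add: nat_combs_zero)
    then show "e \<in> U" unfolding U_def by blast
  qed
  show "Idl\<^bsub>?R\<^esub> (tmon ` E) = monomial_span U"
  proof
    show "Idl\<^bsub>?R\<^esub> (tmon ` E) \<subseteq> monomial_span U"
      using EU by (intro genideal_minimal ideal_monomial_span U) auto
    show "monomial_span U \<subseteq> Idl\<^bsub>?R\<^esub> (tmon ` E)"
    proof (rule monomial_span_subset_ideal[OF genideal_ideal[OF car]])
      show "tmon ` U \<subseteq> Idl\<^bsub>?R\<^esub> (tmon ` E)"
      proof
        fix p assume "p \<in> (tmon ` U :: ((int ^ 'd) \<Rightarrow>\<^sub>0 'k) set)"
        then obtain e m where em: "p = tmon (m + e)" "e \<in> E" "m \<in> nat_combs A"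
          unfolding U_def by (auto simp: add.commute)
        then have "tmon m * tmon e \<in> Idl\<^bsub>?R\<^esub> (tmon ` E)"
          using genideal_self[OF car] by (intro ideal_closed_mult[OF genideal_ideal[OF car]]) auto
        then show "p \<in> Idl\<^bsub>?R\<^esub> (tmon ` E)" by (simp add: em(1) tmon_mult)
      qed
    qed
  qed
qed

text \<open>Passing to exponents turns monomial ideals of the ring into semigroup ideals of the monoid.\<close>

lemma monomial_ideal_iff: "monomial_ideal A I \<longleftrightarrow> (\<exists>U. exponent_ideal A U \<and> I = monomial_span U)"
proof
  assume "monomial_ideal A I"
  then obtain E where E: "E \<subseteq> nat_combs A" "I = Idl\<^bsub>semigroup_ring A\<^esub> (tmon ` E)"
    unfolding monomial_ideal_def by blast
  show "\<exists>U. exponent_ideal A U \<and> I = monomial_span U"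
    by (intro exI conjI, rule genideal_tmon(1)[OF E(1)]) (simp add: E(2) genideal_tmon(2)[OF E(1)])
next
  assume "\<exists>U. exponent_ideal A U \<and> I = monomial_span U"
  then obtain U where U: "exponent_ideal A U" "I = monomial_span U" by blast
  then have "U \<subseteq> nat_combs A" by (simp add: exponent_ideal_def)
  have "{u + m | u m. u \<in> U \<and> m \<in> nat_combs A} = U"
  proof (intro equalityI subsetI)
    fix x assume "x \<in> U"
    then have "x = x + 0 \<and> x \<in> U \<and> 0 \<in> nat_combs A" by (simp add: nat_combs_zero)
    then show "x \<in> {u + m | u m. u \<in> U \<and> m \<in> nat_combs A}" by blast
  qed (use U(1) in \<open>auto simp: exponent_ideal_def\<close>)
  then show "monomial_ideal A I"
    using genideal_tmon(2)[OF \<open>U \<subseteq> nat_combs A\<close>] \<open>U \<subseteq> nat_combs A\<close>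
    by (auto simp: monomial_ideal_def U(2) intro!: exI[of _ U])
qed

lemma std_monomial_span: "std A (monomial_span U) = nat_combs A - U"
  by (auto simp: std_def)

lemma tmon_pow: "tmon a [^]\<^bsub>semigroup_ring A\<^esub> (n::nat) = tmon (int n *s a)"
proof (induction n)
  case 0
  then show ?case by (simp add: nat_pow_def tmon_0)
next
  case (Suc n)
  have "a + int n *s a = int (Suc n) *s a" by (simp add: vec_eq_iff algebra_simps)
  with Suc show ?case by (simp add: nat_pow_def tmon_mult add.commute)
qed


section \<open>Affine monoids and their cones\<close>

lemma nat_combs_generator:
  assumes "finite S" "a \<in> S"
  shows "a \<in> nat_combs S"
proof -
  have "(\<Sum>x\<in>S. int (if x = a then 1 else 0) *s x) = (\<Sum>x\<in>S. if x = a then x else 0)"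
    by (intro sum.cong) auto
  also have "\<dots> = a" using assms by simp
  finally show ?thesis
    unfolding nat_combs_def by (intro CollectI exI[of _ "\<lambda>x. if x = a then 1 else 0"]) simp
qed

lemma nat_combs_scale:
  assumes "x \<in> nat_combs S"
  shows "int n *s x \<in> nat_combs S"
proof (induction n)
  case 0
  then show ?case by (simp add: nat_combs_zero)
next
  case (Suc n)
  have "int (Suc n) *s x = int n *s x + x" by (simp add: vec_eq_iff algebra_simps)
  then show ?case using nat_combs_add[OF Suc assms] by metis
qed

lemma nat_combs_remove_summand:
  assumes "finite S" "a \<in> S" "n \<le> c a"
  shows "(\<Sum>x\<in>S. int (c x) *s x) - int n *s a \<in> nat_combs S"
proof -
  have "(\<Sum>x\<in>S. int ((c(a := c a - n)) x) *s x) =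
      int (c a - n) *s a + (\<Sum>x\<in>S - {a}. int (c x) *s x)"
    using assms(1,2) by (simp add: sum.remove[of S a])
  also have "int (c a - n) *s a = int (c a) *s a - int n *s a"
    using assms(3) by (simp add: of_nat_diff vector_sub_rdistrib)
  also have "\<dots> + (\<Sum>x\<in>S - {a}. int (c x) *s x) = (\<Sum>x\<in>S. int (c x) *s x) - int n *s a"
    using assms(1,2) by (simp add: sum.remove[of S a])
  finally show ?thesis
    unfolding nat_combs_def by (intro CollectI exI[of _ "c(a := c a - n)"]) metis
qed

lemma int_combs_diff:
  assumes "x \<in> int_combs S" "y \<in> int_combs S"
  shows "x - y \<in> int_combs S"
proof -
  obtain u v u' v' where "u \<in> nat_combs S" "v \<in> nat_combs S" "x = u - v"
    "u' \<in> nat_combs S" "v' \<in> nat_combs S" "y = u' - v'"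
    using assms unfolding int_combs_iff by blast
  moreover from this have "x - y = (u + v') - (v + u')" by simp
  ultimately show ?thesis unfolding int_combs_iff by (meson nat_combs_add)
qed

lemma nat_combs_subset_int_combs: "x \<in> nat_combs S \<Longrightarrow> x \<in> int_combs S"
  unfolding int_combs_iff by (intro bexI[of _ x] bexI[of _ 0]) (simp_all add: nat_combs_zero)

text \<open>An element of the group is a difference of monoid elements; add up the subtracted parts.\<close>

lemma int_combs_common_denominator:
  assumes "finite X" "X \<subseteq> int_combs S"
  shows "\<exists>f\<in>nat_combs S. \<forall>x\<in>X. x + f \<in> nat_combs S"
  using assms
proof (induction X)
  case empty
  then show ?case using nat_combs_zero by blast
next
  case (insert x X)
  then obtain f where f: "f \<in> nat_combs S" "\<And>y. y \<in> X \<Longrightarrow> y + f \<in> nat_combs S" by auto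
  have "x \<in> int_combs S" using insert.prems by simp
  then obtain u v where uv: "u \<in> nat_combs S" "v \<in> nat_combs S" "x = u - v"
    unfolding int_combs_iff by blast
  have "x + (f + v) \<in> nat_combs S"
    using nat_combs_add[OF uv(1) f(1)] uv(3) by (simp add: algebra_simps)
  moreover have "y + (f + v) \<in> nat_combs S" if "y \<in> X" for y
    using nat_combs_add[OF f(2)[OF that] uv(2)] by (simp add: add.assoc)
  ultimately show ?case using nat_combs_add[OF f(1) uv(2)] by blast
qed

lemma real_vec_in_real_cone:
  assumes "x \<in> nat_combs S"
  shows "real_vec x \<in> real_cone S"
proof -
  obtain c where "x = (\<Sum>a\<in>S. int (c a) *s a)" using assms unfolding nat_combs_def by blast
  then have "real_vec x = (\<Sum>a\<in>S. real (c a) *\<^sub>R real_vec a)" by (simp add: real_vec_sum)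
  then show ?thesis unfolding real_cone_def by (intro CollectI exI[of _ "\<lambda>a. real (c a)"]) simp
qed

lemma real_cone_scale:
  assumes "x \<in> real_cone S" "0 \<le> t"
  shows "t *\<^sub>R x \<in> real_cone S"
proof -
  obtain c where "x = (\<Sum>a\<in>S. c a *\<^sub>R real_vec a)" "\<forall>a\<in>S. 0 \<le> c a"
    using assms(1) unfolding real_cone_def by blast
  then show ?thesis
    unfolding real_cone_def
    by (intro CollectI exI[of _ "\<lambda>a. t * c a"]) (simp add: scaleR_sum_right assms(2))
qed

text \<open>The midpoint of \<open>2x\<close> and \<open>2y\<close> is \<open>x + y\<close>, so the extremality condition of a face, which speaks
  of segments, gives an additive condition for cones.\<close>

lemma real_cone_face_split:
  assumes face: "real_cone F face_of real_cone A"
    and "x \<in> real_cone A" "y \<in> real_cone A" "x + y \<in> real_cone F"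
  shows "x \<in> real_cone F"
proof -
  have half: "x \<in> real_cone F" if "2 *\<^sub>R x \<in> real_cone F"
    using real_cone_scale[OF that, of "1/2"] by simp
  show ?thesis
  proof (cases "x = y")
    case True
    then show ?thesis using assms(4) half by (simp add: scaleR_2)
  next
    case False
    have "x + y \<in> open_segment (2 *\<^sub>R x) (2 *\<^sub>R y)"
      using False unfolding in_segment by (auto intro!: exI[of _ "1/2"])
    from face_ofD[OF face this] have "2 *\<^sub>R x \<in> real_cone F"
      using assms(2-4) by (simp add: real_cone_scale)
    then show ?thesis by (rule half)
  qed
qed

text \<open>If the origin were a convex combination of the generators, then the negative of a generator
  occurring in it would lie in the cone, which would therefore contain a line. So the origin
  can be strictly separated from the convex hull of the generators.\<close>

lemma positive_functional:
  fixes A :: "(int ^ 'd::finite) set"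
  assumes "finite A" "0 \<notin> A" and pointed: "\<not> contains_line (real_cone A)"
  obtains w and \<beta> :: real where "0 < \<beta>" "\<And>a. a \<in> A \<Longrightarrow> \<beta> < w \<bullet> real_vec a"
proof -
  have inj: "inj_on real_vec A" by (auto intro: inj_onI)
  have "0 \<notin> convex hull (real_vec ` A)"
  proof
    assume "0 \<in> convex hull (real_vec ` A)"
    then obtain u where u: "\<forall>x\<in>real_vec ` A. 0 \<le> u x" "sum u (real_vec ` A) = 1"
      "(\<Sum>x\<in>real_vec ` A. u x *\<^sub>R x) = 0"
      using assms(1) by (auto simp: convex_hull_finite)
    define c where "c a = u (real_vec a)" for a
    have c: "\<And>a. a \<in> A \<Longrightarrow> 0 \<le> c a" "sum c A = 1" "(\<Sum>a\<in>A. c a *\<^sub>R real_vec a) = 0"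
      using u by (auto simp: c_def sum.reindex[OF inj])
    obtain a0 where a0: "a0 \<in> A" "0 < c a0"
      using c(1,2) by (metis less_eq_real_def sum.neutral zero_neq_one)
    have "t *\<^sub>R real_vec a0 \<in> real_cone A" for t
    proof -
      \<comment> \<open>A multiple of the vanishing combination compensates a negative coefficient of the generator.\<close>
      define e where "e a = \<bar>t\<bar> / c a0 * c a + (if a = a0 then t else 0)" for a
      have "(\<Sum>a\<in>A. e a *\<^sub>R real_vec a) =
          (\<bar>t\<bar> / c a0) *\<^sub>R (\<Sum>a\<in>A. c a *\<^sub>R real_vec a) + (\<Sum>a\<in>A. (if a = a0 then t *\<^sub>R real_vec a else 0))"
        unfolding scaleR_sum_right sum.distrib[symmetric]
        by (intro sum.cong) (auto simp: e_def scaleR_left_distrib)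
      also have "\<dots> = t *\<^sub>R real_vec a0" using a0(1) assms(1) c(3) by simp
      finally have "t *\<^sub>R real_vec a0 = (\<Sum>a\<in>A. e a *\<^sub>R real_vec a)" ..
      moreover have "0 \<le> e a" if "a \<in> A" for a
        using c(1)[OF that] a0(2) by (auto simp: e_def)
      ultimately show ?thesis unfolding real_cone_def by blast
    qed
    moreover have "real_vec a0 \<noteq> 0" using a0(1) assms(2) by auto
    ultimately have "contains_line (real_cone A)"
      unfolding contains_line_def by (intro exI[of _ 0] exI[of _ "real_vec a0"]) simp
    then show False using pointed by simp
  qed
  moreover have "closed (convex hull (real_vec ` A))"
    using assms(1) by (intro compact_imp_closed finite_imp_compact_convex_hull) simp
  ultimately obtain w \<beta> where "0 < \<beta>" "\<forall>x\<in>convex hull (real_vec ` A). \<beta> < w \<bullet> x"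
    using separating_hyperplane_closed_0[OF convex_convex_hull] by blast
  then show thesis using that[of \<beta> w] by (meson hull_inc imageI)
qed

text \<open>A nonzero element of the monoid raises a positive functional by at least \<open>\<beta>\<close>, so
  rounding the functional down in units of \<open>\<beta>\<close> gives a natural number that strictly increases. It serves to
  find minimal elements.\<close>

lemma nat_combs_height:
  fixes A :: "(int ^ 'd::finite) set"
  assumes "finite A" "0 \<notin> A" "\<not> contains_line (real_cone A)"
  obtains h :: "int ^ 'd \<Rightarrow> nat"
  where "\<And>x y. x \<in> nat_combs A \<Longrightarrow> y \<in> nat_combs A \<Longrightarrow> y \<noteq> 0 \<Longrightarrow> h x < h (x + y)"
proof -
  obtain w \<beta> where \<beta>: "0 < \<beta>" and w: "\<And>a. a \<in> A \<Longrightarrow> \<beta> < w \<bullet> real_vec a"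
    using positive_functional[OF assms] by blast
  have ge: "y = 0 \<or> \<beta> \<le> w \<bullet> real_vec y" and nonneg: "0 \<le> w \<bullet> real_vec y"
    if y: "y \<in> nat_combs A" for y
  proof -
    obtain c where c: "y = (\<Sum>a\<in>A. int (c a) *s a)"
      using y unfolding nat_combs_def by blast
    have wy: "w \<bullet> real_vec y = (\<Sum>a\<in>A. real (c a) * (w \<bullet> real_vec a))"
      by (simp add: c real_vec_sum inner_sum_right)
    have nn: "0 \<le> real (c a) * (w \<bullet> real_vec a)" if "a \<in> A" for a
      using w[OF that] \<beta> by (intro mult_nonneg_nonneg) auto
    show "0 \<le> w \<bullet> real_vec y" unfolding wy by (intro sum_nonneg nn)
    show "y = 0 \<or> \<beta> \<le> w \<bullet> real_vec y"
    proof (cases "\<forall>a\<in>A. c a = 0")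
      case True
      then show ?thesis by (simp add: c)
    next
      case False
      then obtain a where a: "a \<in> A" "1 \<le> real (c a)" by force
      have "\<beta> \<le> 1 * (w \<bullet> real_vec a)" using w[OF a(1)] by simp
      also have "\<dots> \<le> real (c a) * (w \<bullet> real_vec a)"
        using a w[OF a(1)] \<beta> by (intro mult_right_mono) auto
      also have "\<dots> \<le> w \<bullet> real_vec y"
        unfolding wy using assms(1) a(1) nn by (intro member_le_sum) auto
      finally show ?thesis ..
    qed
  qed
  define h where "h x = nat \<lfloor>(w \<bullet> real_vec x) / \<beta>\<rfloor>" for x
  have "h x < h (x + y)" if "x \<in> nat_combs A" "y \<in> nat_combs A" "y \<noteq> 0" for x y
  proof -
    have "(w \<bullet> real_vec x) / \<beta> + 1 \<le> (w \<bullet> real_vec (x + y)) / \<beta>"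
      using ge[OF that(2)] that(3) \<beta> by (simp add: inner_add_right field_simps)
    then have "\<lfloor>(w \<bullet> real_vec x) / \<beta>\<rfloor> + 1 \<le> \<lfloor>(w \<bullet> real_vec (x + y)) / \<beta>\<rfloor>"
      by (metis floor_add_int floor_mono of_int_1)
    moreover have "0 \<le> \<lfloor>(w \<bullet> real_vec x) / \<beta>\<rfloor>" using nonneg[OF that(1)] \<beta> by simp
    ultimately show ?thesis unfolding h_def by linarith
  qed
  then show thesis by (rule that)
qed

section \<open>Divisibility modulo a face\<close>

locale face_monoids =
  fixes A F :: "(int ^ 'd::finite) set"
  assumes finite_A: "finite A" and face: "is_face A F"
begin

abbreviation M where "M \<equiv> nat_combs A"
abbreviation N where "N \<equiv> nat_combs F"

lemma F_subset: "F \<subseteq> A"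
  and face_of_cone: "real_cone F face_of real_cone A"
  and in_face: "a \<in> A \<Longrightarrow> real_vec a \<in> real_cone F \<Longrightarrow> a \<in> F"
  using face by (auto simp: is_face_def)

lemma N_subset: "f \<in> N \<Longrightarrow> f \<in> M"
  using nat_combs_mono[OF finite_A F_subset] by blast

text \<open>A face of the cone is a face of the monoid: the generators that occur in \<open>a\<close> are summands of
  \<open>a + b\<close>, hence lie in the real cone of \<open>F\<close> and so in \<open>F\<close>.\<close>

lemma face_split:
  assumes "a \<in> M" "b \<in> M" "a + b \<in> N"
  shows "a \<in> N"
proof -
  have cone_a: "real_vec a \<in> real_cone F"
    using real_vec_in_real_cone[OF assms(3)] assms(1,2)
    by (intro real_cone_face_split[OF face_of_cone, of "real_vec a" "real_vec b"])
      (auto intro: real_vec_in_real_cone)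
  obtain c where c: "a = (\<Sum>x\<in>A. int (c x) *s x)" using assms(1) unfolding nat_combs_def by blast
  have "x \<in> F" if "x \<in> A" "c x \<noteq> 0" for x
  proof (rule in_face[OF that(1)])
    have "a - int 1 *s x \<in> M"
      unfolding c using that by (intro nat_combs_remove_summand finite_A) auto
    then have "a - x \<in> M" by simp
    then have "real_vec (a - x) \<in> real_cone A" by (rule real_vec_in_real_cone)
    then show "real_vec x \<in> real_cone F"
      using that(1) cone_a nat_combs_generator[OF finite_A that(1)]
      by (intro real_cone_face_split[OF face_of_cone, of "real_vec x" "real_vec (a - x)"])
        (auto intro: real_vec_in_real_cone)
  qed
  then have "a = (\<Sum>x\<in>F. int (c x) *s x)"
    unfolding c using finite_A F_subset by (intro sum.mono_neutral_right) auto
  then show ?thesis unfolding nat_combs_def by blast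
qed

text \<open>Divisibility in the localization of the monoid at \<open>F\<close>. On pairs belonging to \<open>F\<close> it is the
  divisibility of pairs, and two elements divide each other exactly when their pairs overlap.\<close>

definition divides_mod_face :: "int ^ 'd \<Rightarrow> int ^ 'd \<Rightarrow> bool" (infix "\<preceq>" 50) where
  "c \<preceq> c' \<longleftrightarrow> (\<exists>m\<in>M. \<exists>f\<in>N. c + m = c' + f)"

lemma divides_mod_faceI: "m \<in> M \<Longrightarrow> f \<in> N \<Longrightarrow> c + m = c' + f \<Longrightarrow> c \<preceq> c'"
  by (auto simp: divides_mod_face_def)

lemma divides_mod_face_trans:
  assumes "x \<preceq> y" "y \<preceq> z"
  shows "x \<preceq> z"
proof -
  obtain m f m' f' where *: "m \<in> M" "f \<in> N" "x + m = y + f" "m' \<in> M" "f' \<in> N" "y + m' = z + f'"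
    using assms unfolding divides_mod_face_def by blast
  show ?thesis
  proof (rule divides_mod_faceI)
    show "m + m' \<in> M" "f + f' \<in> N" using * by (auto intro: nat_combs_add)
    have "x + (m + m') = (y + m') + f" using *(3) by (simp add: algebra_simps)
    then show "x + (m + m') = z + (f + f')" using *(6) by (simp add: algebra_simps)
  qed
qed

text \<open>Mutual divisibility makes the product of the two cofactors a unit of the localization, and by the
  face property a divisor of an element of \<open>N\<close> is in \<open>N\<close>.\<close>

lemma divides_mod_face_antisym:
  assumes "x \<preceq> y" "y \<preceq> x"
  shows "x - y \<in> int_combs F"
proof -
  obtain m f m' f' where *: "m \<in> M" "f \<in> N" "x + m = y + f" "m' \<in> M" "f' \<in> N" "y + m' = x + f'"
    using assms unfolding divides_mod_face_def by blast
  have "(x + m) + (y + m') = (y + f) + (x + f')" using *(3,6) by simp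
  then have "m + m' = f + f'" by (simp add: algebra_simps)
  then have "m \<in> N" using face_split[OF *(1,4)] nat_combs_add[OF *(2,5)] by simp
  moreover have "x - y = f - m" using *(3) by (simp add: algebra_simps)
  ultimately show ?thesis using *(2) unfolding int_combs_iff by blast
qed

lemma int_combs_imp_divides_mod_face:
  assumes "x - y \<in> int_combs F"
  shows "x \<preceq> y"
proof -
  obtain u v where uv: "u \<in> N" "v \<in> N" "x - y = u - v" using assms unfolding int_combs_iff by blast
  then show ?thesis
    by (intro divides_mod_faceI[of v u]) (auto simp: N_subset algebra_simps)
qed

lemma pair_divides_iff_divides_mod_face: "pair_divides A (x, F) (y, F) \<longleftrightarrow> x \<preceq> y"
proof
  assume "pair_divides A (x, F) (y, F)"
  then obtain c where "c \<in> M" "x + c + 0 - y \<in> N"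
    unfolding pair_divides_iff using nat_combs_zero by blast
  then show "x \<preceq> y" by (intro divides_mod_faceI[of c "x + c - y"]) auto
next
  assume "x \<preceq> y"
  then obtain m f where *: "m \<in> M" "f \<in> N" "x + m = y + f" unfolding divides_mod_face_def by blast
  then have "x + m + f' - y \<in> N" if "f' \<in> N" for f' using nat_combs_add[OF *(2) that] by simp
  then show "pair_divides A (x, F) (y, F)" unfolding pair_divides_iff using *(1) by blast
qed

definition lower_set :: "int ^ 'd \<Rightarrow> (int ^ 'd) set" where
  "lower_set b = {c \<in> M. c \<preceq> b}"

lemma lower_set_down:
  assumes "x + y \<in> lower_set b" "x \<in> M" "y \<in> M"
  shows "x \<in> lower_set b"
proof -
  have "x \<preceq> x + y" using assms(3) by (intro divides_mod_faceI[of y 0]) (auto simp: nat_combs_zero)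
  then show ?thesis using assms divides_mod_face_trans by (auto simp: lower_set_def)
qed

lemma translate_in_lower_set:
  assumes "b \<in> M" "f \<in> N"
  shows "b + f \<in> lower_set b"
  using assms
  by (auto simp: lower_set_def N_subset nat_combs_add nat_combs_zero intro!: divides_mod_faceI[of 0 f])

lemma exponent_ideal_lower_set: "exponent_ideal A (M - lower_set b)"
  using lower_set_down by (auto simp: exponent_ideal_def intro: nat_combs_add)

section \<open>Irreducibility\<close>

text \<open>Take an element \<open>p\<close> of \<open>K\<close> outside the smaller ideal and a term \<open>c\<close> of \<open>p\<close> that is minimal for
  divisibility modulo \<open>F\<close> among those with exponent in the down-set. The monomial that carries \<open>c\<close>
  into \<open>b + N\<close> expels from the down-set every term that is not in the class of \<open>c\<close>: a term that
  stays would divide \<open>c\<close>. So modulo the smaller ideal only terms in the class of \<open>b\<close> survive, and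
  a further monomial from \<open>N\<close> clears their denominators.\<close>

lemma larger_ideal_meets_face_translate:
  fixes K :: "((int ^ 'd) \<Rightarrow>\<^sub>0 'k::field) set"
  assumes b: "b \<in> M" and K: "ideal K (semigroup_ring A)"
    and less: "monomial_span (M - lower_set b) \<subset> K"
  obtains q where "q \<noteq> 0" "Poly_Mapping.keys q \<subseteq> N" "tmon b * q \<in> K"
proof -
  obtain p where p: "p \<in> K" "p \<notin> monomial_span (M - lower_set b)" using less by blast
  have pM: "Poly_Mapping.keys p \<subseteq> M"
    using ideal_closed_subset[OF K] p(1) by (auto simp: monomial_span_def)
  define S where "S = Poly_Mapping.keys p \<inter> lower_set b"
  have "S \<noteq> {}" using p(2) pM by (auto simp: S_def monomial_span_def)
  \<comment> \<open>The strict part of the preorder; a minimal element for it exists in every finite set.\<close>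
  define R where "R x y \<longleftrightarrow> x \<preceq> y \<and> \<not> y \<preceq> x" for x y
  have "asymp_on S R" by (auto simp: asymp_on_def R_def)
  moreover have "transp_on S R" unfolding transp_on_def R_def by (meson divides_mod_face_trans)
  ultimately obtain c where c: "c \<in> S" "\<And>x. x \<in> S \<Longrightarrow> x \<noteq> c \<Longrightarrow> \<not> R x c"
    using Finite_Set.bex_min_element[of S R] \<open>S \<noteq> {}\<close> by (auto simp: S_def)
  have c_min: "c - x \<in> int_combs F" if "x \<in> S" "x \<preceq> c" for x
  proof (cases "x = c")
    case True
    then show ?thesis using nat_combs_subset_int_combs[OF nat_combs_zero, of F] by simp
  next
    case False
    then have "c \<preceq> x" using c(2) that by (auto simp: R_def)
    then show ?thesis using that(2) by (rule divides_mod_face_antisym)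
  qed
  obtain m f where m: "m \<in> M" "f \<in> N" "c + m = b + f"
    using c(1) by (auto simp: S_def lower_set_def divides_mod_face_def)
  have near: "x + m - b \<in> int_combs F" if x: "x \<in> Poly_Mapping.keys p" "x + m \<in> lower_set b" for x
  proof -
    have "x \<in> M" using x(1) pM by blast
    have xS: "x \<in> S" using x lower_set_down[OF x(2) \<open>x \<in> M\<close> m(1)] by (simp add: S_def)
    obtain m' f' where m': "m' \<in> M" "f' \<in> N" "x + m + m' = b + f'"
      using x(2) by (auto simp: lower_set_def divides_mod_face_def)
    have "x + (m' + f) + (c + m) = (x + m + m') + (c + f)" by (simp add: algebra_simps)
    also have "\<dots> = (c + f') + (c + m)" unfolding m'(3) m(3) by (simp add: algebra_simps)
    finally have "x + (m' + f) = c + f'" by simp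
    then have "x \<preceq> c"
      using m' m(2) by (intro divides_mod_faceI[of "m' + f" f']) (auto intro: nat_combs_add N_subset)
    then have "f - (c - x) \<in> int_combs F"
      using c_min[OF xS] int_combs_diff[OF nat_combs_subset_int_combs[OF m(2)]] by blast
    moreover have "f = c + m - b" using m(3) by simp
    ultimately show ?thesis by (simp add: algebra_simps)
  qed
  define X where "X = (\<lambda>x. x + m - b) ` {x \<in> Poly_Mapping.keys p. x + m \<in> lower_set b}"
  have "finite X" "X \<subseteq> int_combs F" using near by (auto simp: X_def)
  from int_combs_common_denominator[OF this]
  obtain f1 where f1: "f1 \<in> N" and "\<forall>x\<in>X. x + f1 \<in> N" by blast
  then have clear: "x + m - b + f1 \<in> N" if "x \<in> Poly_Mapping.keys p" "x + m \<in> lower_set b" for x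
    using that by (auto simp: X_def)
  define p' where "p' = tmon (m + f1) * p"
  have mf1: "m + f1 \<in> M" using m(1) f1 by (auto intro: nat_combs_add N_subset)
  have p'K: "p' \<in> K" unfolding p'_def using mf1 by (intro ideal_closed_mult[OF K p(1)]) simp
  have keys_p': "Poly_Mapping.keys p' = (+) (m + f1) ` Poly_Mapping.keys p"
    unfolding p'_def by (rule keys_tmon_mult)
  \<comment> \<open>The part of \<open>p'\<close> outside \<open>b + N\<close> lies in the smaller ideal, hence in \<open>K\<close>, and can be removed.\<close>
  obtain q r where qr: "p' = q + r" "Poly_Mapping.keys q = Poly_Mapping.keys p' \<inter> (+) b ` N"
    "Poly_Mapping.keys r = Poly_Mapping.keys p' - (+) b ` N"
    by (rule poly_mapping_split)
  have "r \<in> monomial_span (M - lower_set b)"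
    unfolding monomial_span_def
  proof (intro CollectI subsetI)
    fix y assume y: "y \<in> Poly_Mapping.keys r"
    then obtain x where x: "x \<in> Poly_Mapping.keys p" "y = m + f1 + x"
      using qr(3) keys_p' by auto
    have xM: "x \<in> M" using x(1) pM by blast
    have "y \<notin> lower_set b"
    proof
      assume "y \<in> lower_set b"
      then have "(x + m) + f1 \<in> lower_set b" using x(2) by (simp add: algebra_simps)
      then have "x + m \<in> lower_set b"
        using xM m(1) f1 by (intro lower_set_down[of "x + m" f1]) (auto intro: nat_combs_add N_subset)
      then have "y - b \<in> N" using clear[OF x(1)] x(2) by (simp add: algebra_simps)
      then have "b + (y - b) \<in> (+) b ` N" by (rule imageI)
      then show False using y qr(3) by simp
    qed
    then show "y \<in> M - lower_set b" using x(2) mf1 xM by (auto intro: nat_combs_add)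
  qed
  then have "r \<in> K" using less by blast
  then have qK: "q \<in> K" using ideal_closed_diff[OF K p'K, of r] qr(1) by simp
  show thesis
  proof (rule that[of "tmon (- b) * q"])
    have cK: "c \<in> Poly_Mapping.keys p" using c(1) by (simp add: S_def)
    have "c + m \<in> lower_set b" using m(2,3) translate_in_lower_set[OF b] by simp
    then have "b + (c + m - b + f1) \<in> (+) b ` N" using clear[OF cK] by blast
    then have "m + f1 + c \<in> Poly_Mapping.keys q"
      using cK by (simp add: qr(2) keys_p' algebra_simps)
    then have "Poly_Mapping.keys (tmon (- b) * q) \<noteq> {}" unfolding keys_tmon_mult by blast
    then show "tmon (- b) * q \<noteq> 0" by auto
    show "Poly_Mapping.keys (tmon (- b) * q) \<subseteq> N" unfolding keys_tmon_mult qr(2) by auto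
    show "tmon b * (tmon (- b) * q) \<in> K"
      using qK by (simp add: mult.assoc[symmetric] tmon_mult tmon_0)
  qed
qed

text \<open>Two larger ideals contain elements \<open>t\<^sup>b p\<close> and \<open>t\<^sup>b q\<close> with \<open>p\<close> and \<open>q\<close> supported in \<open>N\<close>. Their
  intersection contains \<open>t\<^sup>b p q\<close>, whose support is nonempty and contained in the down-set of \<open>b\<close>.\<close>

lemma irreducible_lower_set:
  assumes b: "b \<in> M"
  shows "irreducible_ideal (semigroup_ring A :: ((int ^ 'd) \<Rightarrow>\<^sub>0 'k::field) ring)
    (monomial_span (M - lower_set b))"
proof -
  let ?J = "monomial_span (M - lower_set b) :: ((int ^ 'd) \<Rightarrow>\<^sub>0 'k) set"
  let ?R = "semigroup_ring A :: ((int ^ 'd) \<Rightarrow>\<^sub>0 'k) ring"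
  have "b \<in> lower_set b" using translate_in_lower_set[OF b nat_combs_zero] by simp
  then have "tmon b \<in> carrier ?R - ?J" using b by (simp add: carrier_semigroup_ring)
  then have proper: "?J \<noteq> carrier ?R" by blast
  have False if K: "ideal K ?R" "?J \<subset> K" and L: "ideal L ?R" "?J \<subset> L" and J: "?J = K \<inter> L" for K L
  proof -
    obtain p where p: "p \<noteq> 0" "Poly_Mapping.keys p \<subseteq> N" "tmon b * p \<in> K"
      using larger_ideal_meets_face_translate[OF b K] by blast
    obtain q where q: "q \<noteq> 0" "Poly_Mapping.keys q \<subseteq> N" "tmon b * q \<in> L"
      using larger_ideal_meets_face_translate[OF b L] by blast
    have "p \<in> monomial_span M" "q \<in> monomial_span M"
      using p(2) q(2) N_subset by (auto simp: monomial_span_def)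
    then have "q * (tmon b * p) \<in> K" "p * (tmon b * q) \<in> L"
      by (auto intro: ideal_closed_mult[OF K(1) p(3)] ideal_closed_mult[OF L(1) q(3)])
    then have "tmon b * (p * q) \<in> ?J" unfolding J by (simp add: ac_simps)
    then have sub: "(+) b ` Poly_Mapping.keys (p * q) \<subseteq> M - lower_set b"
      by (simp add: monomial_span_def keys_tmon_mult)
    obtain f where f: "f \<in> Poly_Mapping.keys (p * q)"
      using laurent_no_zero_divisors[OF p(1) q(1)] by 
      (metis poly_mapping_eqI not_in_keys_iff_lookup_eq_zero lookup_zero)
    then have "f \<in> N" using keys_mult[of p q] p(2) q(2) nat_combs_add by blast
    then show False using translate_in_lower_set[OF b] sub f by blast
  qed
  then show ?thesis
    unfolding irreducible_ideal_def using ideal_monomial_span[OF exponent_ideal_lower_set] proper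
    by blast
qed

end

section \<open>Standard pairs of primary monomial ideals\<close>

locale primary_monomial_ideal = face_monoids A F for A F :: "(int ^ 'd::finite) set" +
  fixes I :: "((int ^ 'd) \<Rightarrow>\<^sub>0 'k::field) set"
  assumes zero_notin: "0 \<notin> A"
    and pointed: "\<not> contains_line (real_cone A)"
    and monomial: "monomial_ideal A I"
    and primary: "primary_to (semigroup_ring A) (face_prime A F) I"
begin

abbreviation D where "D \<equiv> std A I"

abbreviation cls where "cls x \<equiv> overlap_class A (x, F)"

lemma D_subset: "D \<subseteq> M"
  by (auto simp: std_def)

lemma exponent_ideal_nonstd: "exponent_ideal A (M - D)"
  and I_eq: "I = monomial_span (M - D)"
proof -
  obtain U where U: "exponent_ideal A U" "I = monomial_span U"
    using monomial unfolding monomial_ideal_iff by blast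
  then have "U = M - D" by (auto simp: std_monomial_span exponent_ideal_def)
  then show "exponent_ideal A (M - D)" "I = monomial_span (M - D)" using U by auto
qed

lemma std_down: "x + m \<in> D \<Longrightarrow> x \<in> M \<Longrightarrow> m \<in> M \<Longrightarrow> x \<in> D"
  using exponent_ideal_nonstd unfolding exponent_ideal_def by blast

lemma tmon_in_I_iff: "tmon x \<in> I \<longleftrightarrow> x \<in> M - D"
  by (subst I_eq) simp

text \<open>The complement of \<open>N\<close> in \<open>M\<close> is a semigroup ideal by the face property, so it is the
  set of exponents of the prime ideal of \<open>F\<close>, to which \<open>I\<close> is primary.\<close>

lemma radical_eq: "ideal_radical (semigroup_ring A) I = monomial_span (M - N)"
proof -
  have "{e + m | e m. e \<in> M - N \<and> m \<in> M} = M - N"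
  proof (intro equalityI subsetI)
    fix x assume "x \<in> M - N"
    then have "x = x + 0 \<and> x \<in> M - N \<and> 0 \<in> M" by (simp add: nat_combs_zero)
    then show "x \<in> {e + m | e m. e \<in> M - N \<and> m \<in> M}" by blast
  qed (use face_split in \<open>auto intro: nat_combs_add\<close>)
  then have "face_prime A F = (monomial_span (M - N) :: ((int ^ 'd) \<Rightarrow>\<^sub>0 'k) set)"
    unfolding face_prime_def using genideal_tmon(2)[of "M - N" A] by simp
  then show ?thesis using primary by (simp add: primary_to_def)
qed

text \<open>Monomials with exponent in \<open>N\<close> are outside the radical of \<open>I\<close>, so they are
  nonzerodivisors modulo the primary ideal \<open>I\<close>.\<close>

lemma std_add_face:
  assumes "x \<in> D" "f \<in> N"
  shows "x + f \<in> D"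
proof (rule ccontr)
  assume "x + f \<notin> D"
  have M: "x \<in> M" "f \<in> M" using assms D_subset N_subset by auto
  then have "tmon x * tmon f \<in> I"
    using \<open>x + f \<notin> D\<close> by (simp add: tmon_mult tmon_in_I_iff nat_combs_add)
  moreover have "tmon x \<notin> I" using assms(1) by (simp add: tmon_in_I_iff)
  ultimately obtain n :: nat where "tmon f [^]\<^bsub>semigroup_ring A\<^esub> n \<in> I"
    using primary M
    unfolding primary_to_def primary_ideal_def carrier_semigroup_ring semigroup_ring_ops
    by (metis tmon_in_monomial_span_iff)
  then have "tmon f \<in> ideal_radical (semigroup_ring A) I"
    using M(2) by (auto simp: ideal_radical_def carrier_semigroup_ring)
  then show False using assms(2) by (simp add: radical_eq)
qed

lemma multiple_notin_std:
  assumes "a \<in> M" "a \<notin> N"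
  obtains n :: nat where "int n *s a \<notin> D"
proof -
  have "tmon a \<in> ideal_radical (semigroup_ring A) I" using assms by (simp add: radical_eq)
  then obtain n :: nat where "tmon a [^]\<^bsub>semigroup_ring A\<^esub> n \<in> I"
    unfolding ideal_radical_def by blast
  then show thesis using that[of n] by (auto simp: tmon_pow tmon_in_I_iff)
qed

text \<open>For \<open>g\<close> in the monoid of \<open>G\<close>, all \<open>b + n g\<close> are standard, hence so are their divisors \<open>n g\<close>,
  which forces \<open>g\<close> into \<open>N\<close>.\<close>

lemma proper_pair_face_subset:
  assumes "proper_pair A I (b, G)"
  shows "b \<in> D" "nat_combs G \<subseteq> N" "G \<subseteq> F"
proof -
  have G: "is_face A G" "b \<in> M" "(+) b ` nat_combs G \<subseteq> D"
    using assms by (auto simp: proper_pair_def pairs_def)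
  have GA: "G \<subseteq> A" using G(1) by (simp add: is_face_def)
  have "b + 0 \<in> D" using G(3) nat_combs_zero by blast
  then show "b \<in> D" by simp
  show sub: "nat_combs G \<subseteq> N"
  proof (rule ccontr)
    assume "\<not> nat_combs G \<subseteq> N"
    then obtain g where g: "g \<in> nat_combs G" "g \<notin> N" by blast
    have gM: "g \<in> M" using g(1) nat_combs_mono[OF finite_A GA] by blast
    obtain n :: nat where n: "int n *s g \<notin> D" using multiple_notin_std[OF gM g(2)] .
    have "int n *s g + b \<in> D" using G(3) nat_combs_scale[OF g(1), of n] by (auto simp: add.commute)
    then have "int n *s g \<in> D" using nat_combs_scale[OF gM] G(2) by (rule std_down)
    then show False using n by simp
  qed
  show "G \<subseteq> F"
  proof
    fix g assume g: "g \<in> G"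
    then have "g \<in> N" using sub nat_combs_generator[OF finite_subset[OF GA finite_A]] by blast
    then show "g \<in> F" using g GA by (intro in_face real_vec_in_real_cone) auto
  qed
qed

lemma proper_pair_iff: "proper_pair A I (b, F) \<longleftrightarrow> b \<in> D"
  using proper_pair_face_subset(1)[of b F] std_add_face D_subset face
  by (auto simp: proper_pair_def pairs_def)

lemma pair_in_pairs: "x \<in> M \<Longrightarrow> (x, F) \<in> pairs A"
  using face by (simp add: pairs_def)

lemma standard_pair_belongs:
  assumes "standard_pair A I (b, G)"
  shows "G = F" "b \<in> D"
proof -
  have p: "proper_pair A I (b, G)" using assms by (simp add: standard_pair_def)
  show "b \<in> D" using proper_pair_face_subset(1)[OF p] .
  then have "proper_pair A I (b, F)" by (simp add: proper_pair_iff)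
  moreover have "pair_set (b, G) \<subseteq> pair_set (b, F)" using proper_pair_face_subset(2)[OF p] by auto
  ultimately show "G = F" using assms unfolding standard_pair_def by blast
qed

text \<open>Among the \<open>b\<close> with \<open>c\<close> in \<open>b + N\<close>, one of least height gives a maximal pair: a proper
  pair that contains \<open>b + N\<close> starts either at some \<open>b'\<close> of smaller height with \<open>b - b'\<close> in \<open>N\<close>, or
  at \<open>b\<close> itself, and then its face is \<open>F\<close>.\<close>

lemma std_covered:
  assumes "c \<in> D"
  obtains b where "standard_pair A I (b, F)" "c - b \<in> N"
proof -
  obtain h :: "int ^ 'd \<Rightarrow> nat"
    where h: "\<And>x y. x \<in> M \<Longrightarrow> y \<in> M \<Longrightarrow> y \<noteq> 0 \<Longrightarrow> h x < h (x + y)"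
    using nat_combs_height[OF finite_A zero_notin pointed] by blast
  have "\<exists>b. (b \<in> M \<and> c - b \<in> N) \<and> (\<forall>y. y \<in> M \<and> c - y \<in> N \<longrightarrow> h b \<le> h y)"
    by (rule ex_has_least_nat[of _ c]) (use assms D_subset nat_combs_zero in auto)
  then obtain b where b: "b \<in> M" "c - b \<in> N" and least: "\<And>y. y \<in> M \<Longrightarrow> c - y \<in> N \<Longrightarrow> h b \<le> h y"
    by blast
  have bD: "b \<in> D" using assms b by (intro std_down[of b "c - b"]) (auto intro: N_subset)
  have "standard_pair A I (b, F)"
    unfolding standard_pair_def
  proof (intro conjI allI impI)
    show "proper_pair A I (b, F)" using bD by (simp add: proper_pair_iff)
    fix Q assume Q: "proper_pair A I Q \<and> pair_set (b, F) \<subseteq> pair_set Q"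
    obtain b' G where QG: "Q = (b', G)" by (cases Q)
    then have p: "proper_pair A I (b', G)" and sub: "(+) b ` N \<subseteq> (+) b' ` nat_combs G" using Q by auto
    note GN = proper_pair_face_subset[OF p]
    have "b + 0 \<in> (+) b' ` nat_combs G" using sub nat_combs_zero by blast
    then obtain g where g: "g \<in> nat_combs G" "b = b' + g" by auto
    have b'M: "b' \<in> M" using GN(1) D_subset by blast
    have "b' = b"
    proof (rule ccontr)
      assume "b' \<noteq> b"
      then have "h b' < h (b' + g)" using g GN(2) by (intro h b'M) (auto intro: N_subset)
      moreover have "c - b' \<in> N" using nat_combs_add[OF b(2), of g] g GN(2) by (auto simp: algebra_simps)
      ultimately show False using least[OF b'M] g(2) by fastforce
    qed
    then have "(+) b ` N \<subseteq> (+) b ` nat_combs G" using sub by simp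
    then have NG: "N \<subseteq> nat_combs G" by auto
    have "F \<subseteq> G"
    proof
      fix x assume x: "x \<in> F"
      have "x \<in> N" using x nat_combs_generator[OF finite_subset[OF F_subset finite_A]] by blast
      then have "real_vec x \<in> real_cone G" using NG by (blast intro: real_vec_in_real_cone)
      moreover have "is_face A G" using p by (simp add: proper_pair_def pairs_def)
      ultimately show "x \<in> G" using x F_subset unfolding is_face_def by blast
    qed
    then show "Q = (b, F)" using QG \<open>b' = b\<close> GN(3) by blast
  qed
  then show thesis using b(2) by (rule that)
qed

lemma cls_eq_iff:
  assumes "x \<in> M" "y \<in> M"
  shows "cls x = cls y \<longleftrightarrow> x - y \<in> int_combs F"
  using eq_equiv_class_iff[OF equiv_overlap pair_in_pairs[OF assms(1)] pair_in_pairs[OF assms(2)]]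
    pair_in_pairs[OF assms(1)] pair_in_pairs[OF assms(2)]
  by (simp add: overlap_class_def overlap_def)

lemma cls_eq_imp_divides:
  assumes "cls x = cls y" "x \<in> M" "y \<in> M"
  shows "x \<preceq> y"
  using assms cls_eq_iff int_combs_imp_divides_mod_face by blast

lemma class_divides_cls_iff:
  assumes "x \<in> M" "y \<in> M"
  shows "class_divides A (cls x) (cls y) \<longleftrightarrow> x \<preceq> y"
  using class_divides_iff[OF finite_A pair_in_pairs[OF assms(1)] pair_in_pairs[OF assms(2)]]
  unfolding pair_divides_iff_divides_mod_face .

lemma std_down_divides:
  assumes "x \<preceq> y" "x \<in> M" "y \<in> D"
  shows "x \<in> D"
proof -
  obtain m f where "m \<in> M" "f \<in> N" "x + m = y + f" using assms(1) unfolding divides_mod_face_def by blast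
  then show ?thesis using std_add_face[OF assms(3)] std_down[of x m] assms(2) by simp
qed

text \<open>A standard exponent is congruent, modulo the group of \<open>F\<close>, to the base point of any standard pair
  that covers it. Working with all of \<open>D\<close> avoids tracking which exponents are base points of standard pairs.\<close>

lemma standard_classes_eq: "standard_classes A I = cls ` D"
proof (intro equalityI subsetI)
  fix C assume "C \<in> standard_classes A I"
  then obtain b G where "standard_pair A I (b, G)" "C = overlap_class A (b, G)"
    by (auto simp: standard_classes_def)
  then show "C \<in> cls ` D" using standard_pair_belongs by blast
next
  fix C assume "C \<in> cls ` D"
  then obtain c where c: "c \<in> D" "C = cls c" by blast
  obtain b where b: "standard_pair A I (b, F)" "c - b \<in> N" using std_covered[OF c(1)] .
  have "cls c = cls b"
    using c(1) D_subset standard_pair_belongs(2)[OF b(1)] b(2)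
    by (subst cls_eq_iff) (auto intro: nat_combs_subset_int_combs)
  then show "C \<in> standard_classes A I" using b(1) c(2) by (auto simp: standard_classes_def)
qed

text \<open>For each generator outside \<open>F\<close> some multiple is not standard, which bounds its coefficient in
  every standard exponent. Modulo \<open>F\<close> only these boundedly many coefficients matter.\<close>

lemma finite_standard_classes: "finite (standard_classes A I)"
proof -
  have "\<exists>n::nat. int n *s a \<notin> D" if "a \<in> A - F" for a
  proof -
    have "a \<notin> N" using that in_face real_vec_in_real_cone by blast
    then show ?thesis
      using that multiple_notin_std nat_combs_generator[OF finite_A] by (metis DiffD1)
  qed
  then obtain n :: "int ^ 'd \<Rightarrow> nat" where n: "\<And>a. a \<in> A - F \<Longrightarrow> int (n a) *s a \<notin> D" by metis
  define P where "P = PiE (A - F) (\<lambda>a. {..<n a})"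
  have "cls x \<in> (\<lambda>c. cls (\<Sum>a\<in>A - F. int (c a) *s a)) ` P" if x: "x \<in> D" for x
  proof -
    have xM: "x \<in> M" using x D_subset by blast
    then obtain c where c: "x = (\<Sum>a\<in>A. int (c a) *s a)" unfolding nat_combs_def by blast
    have "c a < n a" if a: "a \<in> A - F" for a
    proof (rule ccontr)
      assume "\<not> c a < n a"
      then have le: "n a \<le> c a" by simp
      have "x - int (n a) *s a \<in> M"
        unfolding c using a le by (intro nat_combs_remove_summand finite_A) auto
      moreover have "int (n a) *s a \<in> M"
        using a by (intro nat_combs_scale nat_combs_generator finite_A) simp
      ultimately have "int (n a) *s a \<in> D" using x std_down[of "int (n a) *s a" "x - int (n a) *s a"] by simp
      then show False using n[OF a] by simp
    qed
    then have P: "restrict c (A - F) \<in> P" by (auto simp: P_def)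
    let ?s = "\<Sum>a\<in>A - F. int (c a) *s a"
    have "x = ?s + (\<Sum>a\<in>F. int (c a) *s a)"
      unfolding c by (rule sum.subset_diff[OF F_subset finite_A])
    then have "x - ?s \<in> N" unfolding nat_combs_def by auto
    moreover have "?s \<in> M"
      using nat_combs_mono[OF finite_A, of "A - F"] unfolding nat_combs_def[of "A - F"] by blast
    ultimately have "cls x = cls ?s" using xM by (simp add: cls_eq_iff nat_combs_subset_int_combs)
    also have "?s = (\<Sum>a\<in>A - F. int (restrict c (A - F) a) *s a)" by (intro sum.cong) auto
    finally show ?thesis using P by blast
  qed
  moreover have "finite P" using finite_A by (auto simp: P_def intro: finite_PiE)
  ultimately show ?thesis unfolding standard_classes_eq by (meson finite_imageI finite_subset image_subsetI)
qed

lemma cls_maximal_iff: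
  assumes "x \<in> M"
  shows "cls x \<in> maximal_classes A I \<longleftrightarrow> x \<in> D \<and> (\<forall>y\<in>D. x \<preceq> y \<longrightarrow> y \<preceq> x)"
proof -
  have "cls x \<in> cls ` D \<longleftrightarrow> x \<in> D"
  proof
    assume "cls x \<in> cls ` D"
    then obtain y where y: "y \<in> D" "cls x = cls y" by blast
    then have "x \<preceq> y" using assms D_subset by (auto intro: cls_eq_imp_divides)
    then show "x \<in> D" using assms y(1) by (rule std_down_divides)
  qed auto
  moreover have "(x \<preceq> y \<longrightarrow> cls y = cls x) \<longleftrightarrow> (x \<preceq> y \<longrightarrow> y \<preceq> x)" if "y \<in> D" for y
    using that assms D_subset cls_eq_iff[of y x]
    by (meson divides_mod_face_antisym int_combs_imp_divides_mod_face subsetD)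
  ultimately show ?thesis
    using D_subset assms by (auto simp: maximal_classes_def standard_classes_eq class_divides_cls_iff subset_iff)
qed

text \<open>Finitely many representatives \<open>D0\<close> suffice, and a maximal element of the strict part of
  divisibility among those above \<open>x\<close> is maximal in all of \<open>D\<close>.\<close>

lemma divides_maximal:
  assumes "x \<in> D"
  obtains y where "y \<in> D" "x \<preceq> y" "cls y \<in> maximal_classes A I"
proof -
  have "finite (cls ` D)" using finite_standard_classes by (simp add: standard_classes_eq)
  then obtain D0 where D0: "D0 \<subseteq> D" "finite D0" "cls ` D = cls ` D0"
    using finite_subset_image[of "cls ` D" cls D] by auto
  have rep: "\<exists>t\<in>D0. s \<preceq> t" if s: "s \<in> D" for s
  proof -
    obtain t where "t \<in> D0" "cls s = cls t" using D0(3) s by blast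
    then show ?thesis
      using s D0(1) D_subset by (meson cls_eq_imp_divides subsetD)
  qed
  define S where "S = {t \<in> D0. x \<preceq> t}"
  define R where "R s t \<longleftrightarrow> s \<preceq> t \<and> \<not> t \<preceq> s" for s t
  have "asymp_on S R" by (auto simp: asymp_on_def R_def)
  moreover have "transp_on S R" unfolding transp_on_def R_def by (meson divides_mod_face_trans)
  moreover have "finite S" "S \<noteq> {}" using D0(2) rep[OF assms] by (auto simp: S_def)
  ultimately obtain y where y: "y \<in> S" "\<And>t. t \<in> S \<Longrightarrow> t \<noteq> y \<Longrightarrow> \<not> R y t"
    using Finite_Set.bex_max_element[of S R] by blast
  have yD: "y \<in> D" and xy: "x \<preceq> y" using y(1) D0(1) by (auto simp: S_def)
  have "z \<preceq> y" if z: "z \<in> D" "y \<preceq> z" for z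
  proof -
    obtain t where t: "t \<in> D0" "z \<preceq> t" using rep[OF z(1)] by blast
    have yt: "y \<preceq> t" using divides_mod_face_trans[OF z(2) t(2)] .
    have "t \<in> S" using t(1) divides_mod_face_trans[OF xy yt] by (simp add: S_def)
    then have "t \<preceq> y" using y(2)[of t] yt by (auto simp: R_def)
    then show ?thesis using divides_mod_face_trans[OF t(2)] by blast
  qed
  then have "cls y \<in> maximal_classes A I" using yD D_subset by (subst cls_maximal_iff) auto
  then show thesis using that yD xy by blast
qed

text \<open>Moving along \<open>N\<close> does not change divisibility modulo \<open>F\<close>, so the union of the
  translates \<open>b' + N\<close> over the standard pairs dividing \<open>b\<close> contains each standard exponent dividing
  \<open>b\<close>.\<close>

lemma divisor_set_eq:
  assumes "b \<in> D"
  shows "divisor_set A F I b = lower_set b"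
proof (intro equalityI subsetI)
  have bM: "b \<in> M" using assms D_subset by blast
  fix x assume "x \<in> divisor_set A F I b"
  then obtain b' f where b': "standard_pair A I (b', F)" "class_divides A (cls b') (cls b)"
    and f: "f \<in> N" "x = b' + f"
    by (auto simp: divisor_set_def)
  have b'M: "b' \<in> M" using standard_pair_belongs(2)[OF b'(1)] D_subset by blast
  have "b' \<preceq> b" using b'(2) b'M bM by (simp add: class_divides_cls_iff)
  moreover have "x \<preceq> b'"
    using f by (intro int_combs_imp_divides_mod_face) (simp add: nat_combs_subset_int_combs)
  ultimately have "x \<preceq> b" by (metis divides_mod_face_trans)
  then show "x \<in> lower_set b"
    using b'M f by (auto simp: lower_set_def intro: nat_combs_add N_subset)
next
  have bM: "b \<in> M" using assms D_subset by blast
  fix x assume "x \<in> lower_set b"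
  then have x: "x \<in> M" "x \<preceq> b" by (auto simp: lower_set_def)
  then have "x \<in> D" using assms by (blast intro: std_down_divides)
  then obtain b' where b': "standard_pair A I (b', F)" "x - b' \<in> N" using std_covered by blast
  have b'M: "b' \<in> M" using standard_pair_belongs(2)[OF b'(1)] D_subset by blast
  have "b' \<preceq> x"
    using b'(2) by (intro divides_mod_faceI[of "x - b'" 0]) (auto simp: nat_combs_zero N_subset)
  then have "b' \<preceq> b" using x(2) by (rule divides_mod_face_trans)
  then have "class_divides A (cls b') (cls b)" using b'M bM by (simp add: class_divides_cls_iff)
  moreover have "b' + (x - b') \<in> pair_set (b', F)" using b'(2) unfolding pair_set.simps by (rule imageI)
  ultimately show "x \<in> divisor_set A F I b" using b'(1) unfolding divisor_set_def by auto
qed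

lemma ex_enumeration: "\<exists>l b. enumerates_maximal_classes A F I l b"
proof -
  have "finite (maximal_classes A I)"
    by (rule finite_subset[OF _ finite_standard_classes]) (auto simp: maximal_classes_def)
  from ex_bij_betw_nat_finite_1[OF this]
  obtain \<phi> where \<phi>: "bij_betw \<phi> {1..card (maximal_classes A I)} (maximal_classes A I)" by blast
  let ?l = "card (maximal_classes A I)"
  have "\<exists>x\<in>M. cls x = \<phi> i" if "i \<in> {1..?l}" for i
  proof -
    have "\<phi> i \<in> cls ` D"
      using bij_betwE[OF \<phi>] that by (auto simp: maximal_classes_def standard_classes_eq)
    then show ?thesis using D_subset by auto
  qed
  then obtain b where b: "\<And>i. i \<in> {1..?l} \<Longrightarrow> b i \<in> M \<and> cls (b i) = \<phi> i" by metis
  then have "bij_betw (\<lambda>i. cls (b i)) {1..?l} (maximal_classes A I)"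
    using \<phi> by (subst bij_betw_cong[of _ _ \<phi>]) auto
  then show ?thesis
    using b pair_in_pairs unfolding enumerates_maximal_classes_def by blast
qed

text \<open>An exponent of \<open>D\<close> lies below some maximal class and so outside the corresponding ideal, which
  gives the intersection. The monomial at \<open>b i\<close> is a witness for irredundancy: it lies
  in every other component, for \<open>b i\<close> divides no other maximal class, but not in \<open>I\<close>.\<close>

lemma irredundant_decomposition_lower_sets:
  assumes "enumerates_maximal_classes A F I l b"
  defines "J \<equiv> \<lambda>i. monomial_span (M - lower_set (b i)) :: ((int ^ 'd) \<Rightarrow>\<^sub>0 'k) set"
  shows "\<forall>i\<in>{1..l}. monomial_ideal A (J i) \<and> divisor_set A F I (b i) = std A (J i) \<and>
      I \<subseteq> J i \<and> irreducible_ideal (semigroup_ring A) (J i)"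
    and "irredundant_irreducible_decomposition (semigroup_ring A) I {1..l} J"
proof -
  have bM: "b i \<in> M" if "i \<in> {1..l}" for i
    using assms(1) that by (auto simp: enumerates_maximal_classes_def pairs_def)
  have bij: "bij_betw (\<lambda>i. cls (b i)) {1..l} (maximal_classes A I)"
    using assms(1) by (simp add: enumerates_maximal_classes_def)
  have max: "b i \<in> D" "\<And>y. y \<in> D \<Longrightarrow> b i \<preceq> y \<Longrightarrow> y \<preceq> b i" if "i \<in> {1..l}" for i
    using bij_betwE[OF bij] that cls_maximal_iff[OF bM[OF that]] by blast+
  have lower_D: "lower_set (b i) \<subseteq> D" if "i \<in> {1..l}" for i
    using max(1)[OF that] std_down_divides by (auto simp: lower_set_def)
  have IJ: "I \<subseteq> J i" if "i \<in> {1..l}" for i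
  proof -
    have "monomial_span (M - D) \<subseteq> J i"
      using lower_D[OF that] by (auto simp: J_def monomial_span_def)
    then show ?thesis by (subst I_eq)
  qed
  have irr: "irreducible_ideal (semigroup_ring A) (J i)" if "i \<in> {1..l}" for i
    unfolding J_def using bM[OF that] by (rule irreducible_lower_set)
  show "\<forall>i\<in>{1..l}. monomial_ideal A (J i) \<and> divisor_set A F I (b i) = std A (J i) \<and>
      I \<subseteq> J i \<and> irreducible_ideal (semigroup_ring A) (J i)"
  proof (intro ballI conjI)
    fix i assume i: "i \<in> {1..l}"
    show "monomial_ideal A (J i)"
      unfolding J_def monomial_ideal_iff using exponent_ideal_lower_set by blast
    show "divisor_set A F I (b i) = std A (J i)"
      using max(1)[OF i] by (auto simp: J_def std_monomial_span divisor_set_eq lower_set_def)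
  qed (fact IJ irr)+
  have covered: "\<exists>i\<in>{1..l}. x \<in> lower_set (b i)" if "x \<in> D" for x
  proof -
    obtain y where y: "y \<in> D" "x \<preceq> y" "cls y \<in> maximal_classes A I"
      using divides_maximal[OF \<open>x \<in> D\<close>] .
    obtain i where i: "i \<in> {1..l}" "cls y = cls (b i)"
      using y(3) bij unfolding bij_betw_def by blast
    have "y \<preceq> b i"
      using y(1) D_subset bM[OF i(1)] i(2) by (auto intro: cls_eq_imp_divides)
    then have "x \<preceq> b i" using y(2) by (metis divides_mod_face_trans)
    then show ?thesis using that D_subset i(1) by (auto simp: lower_set_def)
  qed
  show "irredundant_irreducible_decomposition (semigroup_ring A) I {1..l} J"
    unfolding irredundant_irreducible_decomposition_def
  proof (intro conjI ballI)
    show "I = carrier (semigroup_ring A) \<inter> (\<Inter>i\<in>{1..l}. J i)"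
    proof (intro equalityI subsetI)
      fix p assume "p \<in> I"
      then have "p \<in> monomial_span (M - D)" by (subst (asm) I_eq)
      then have "p \<in> carrier (semigroup_ring A)"
        by (auto simp: carrier_semigroup_ring monomial_span_def)
      then show "p \<in> carrier (semigroup_ring A) \<inter> (\<Inter>i\<in>{1..l}. J i)" using IJ \<open>p \<in> I\<close> by blast
    next
      fix p assume "p \<in> carrier (semigroup_ring A) \<inter> (\<Inter>i\<in>{1..l}. J i)"
      then have "Poly_Mapping.keys p \<subseteq> M - D"
        using covered by (fastforce simp: carrier_semigroup_ring J_def monomial_span_def)
      then show "p \<in> I" by (subst I_eq) (simp add: monomial_span_def)
    qed
    fix i assume i: "i \<in> {1..l}"
    have "b i \<notin> lower_set (b j)" if j: "j \<in> {1..l} - {i}" for j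
    proof
      assume "b i \<in> lower_set (b j)"
      then have "b i \<preceq> b j" by (simp add: lower_set_def)
      moreover from this have "b j \<preceq> b i" using max i j by blast
      ultimately have "cls (b i) = cls (b j)"
        using bM i j by (simp add: cls_eq_iff divides_mod_face_antisym)
      then show False using bij i j by (auto simp: bij_betw_def dest: inj_onD)
    qed
    then have "tmon (b i) \<in> carrier (semigroup_ring A) \<inter> (\<Inter>j\<in>{1..l} - {i}. J j)"
      using bM[OF i] by (simp add: carrier_semigroup_ring J_def)
    moreover have "tmon (b i) \<notin> I" using max(1)[OF i] by (simp add: tmon_in_I_iff)
    ultimately show "I \<noteq> carrier (semigroup_ring A) \<inter> (\<Inter>j\<in>{1..l} - {i}. J j)" by blast
  qed (use irr in auto)
qed

end

theorem proposition3p12: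
  fixes A F :: "(int ^ 'd) set" and I :: "((int ^ 'd) \<Rightarrow>\<^sub>0 'k::field) set"
  assumes "infinite (UNIV :: 'k set)"
    and "finite A" and "0 \<notin> A"
    and "int_combs A = UNIV"
    and "\<not> contains_line (real_cone A)"
    and "is_face A F"
    and "monomial_ideal A I"
    and "primary_to (semigroup_ring A) (face_prime A F) I"
  shows "(\<exists>l b. enumerates_maximal_classes A F I l b) \<and>
    (\<forall>l b. enumerates_maximal_classes A F I l b \<longrightarrow>
      (\<exists>J. (\<forall>i\<in>{1..l}.
              monomial_ideal A (J i) \<and>
              divisor_set A F I (b i) = std A (J i) \<and>
              I \<subseteq> J i \<and>
              irreducible_ideal (semigroup_ring A) (J i)) \<and>
           irredundant_irreducible_decomposition (semigroup_ring A) I {1..l} J))"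
proof -
  interpret primary_monomial_ideal A F I
    using assms by unfold_locales
  show ?thesis
  proof (intro conjI allI impI)
    fix l b assume "enumerates_maximal_classes A F I l b"
    note decomposition = irredundant_decomposition_lower_sets[OF this]
    show "\<exists>J. (\<forall>i\<in>{1..l}.
              monomial_ideal A (J i) \<and>
              divisor_set A F I (b i) = std A (J i) \<and>
              I \<subseteq> J i \<and>
              irreducible_ideal (semigroup_ring A) (J i)) \<and>
           irredundant_irreducible_decomposition (semigroup_ring A) I {1..l} J"
      by (rule exI, rule conjI, rule decomposition(1), rule decomposition(2))
  qed (rule ex_enumeration)
qed

end
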